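(* Let $A$ be a unital simple $C^*$-algebra with a unique trace, and let $m\ge 1$. Suppose $A$ is not isomorphic to the algebra of complex numbers $\mathbb{C}$. Then the Bernoulli action $\sigma:\mathbb{Z}^m\to \mathrm{Aut}\big(\bigotimes_{\mathbb{Z}^m}A\big)$ is strongly outer.
   Context: "Trace" means tracial state; $T(\cdot)$ denotes the set of tracial states. All tensor products are minimal. For a unital $C^*$-algebra $A$ and a discrete group $\Gamma$, $\bigotimes_\Gamma A$ is the inductive limit of $\{\bigotimes_F A: F\subseteq\Gamma\text{ finite}\}$ with the natural inclusions (tensoring with units) as connecting maps. The left translation action of $\Gamma$ on itself induces the Bernoulli action $\sigma:\Gamma\to\mathrm{Aut}(\bigotimes_\Gamma A)$, permuting tensor factors. An action $\alpha:\Gamma\to\mathrm{Aut}(C)$ of a discrete group on a unital $C^*$-algebra $C$ with $T(C)\ne\emptyset$ is strongly outer if for every $g\in\Gamma\setminus\{e\}$ and every $\alpha^g$-invariant $\tau\in T(C)$, the extension $\tilde\alpha^g$ of $\alpha^g$ to $\pi_\tau(C)''$ ($\pi_\tau$ the GNS representation) is an outer automorphism (not of the form $\mathrm{Ad}\,W$ for a unitary $W\in\pi_\tau(C)''$). *)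

theory Defs
  imports "HOL-Analysis.Analysis"
begin

section \<open>Complex normed spaces, unital C*-algebras, Hilbert spaces\<close>

class complex_vector = real_vector +
  fixes scaleC :: "complex \<Rightarrow> 'a \<Rightarrow> 'a"  (infixr "*\<^sub>C" 75)
  assumes scaleC_add_right: "c *\<^sub>C (x + y) = c *\<^sub>C x + c *\<^sub>C y"
    and scaleC_add_left: "(c + d) *\<^sub>C x = c *\<^sub>C x + d *\<^sub>C x"
    and scaleC_scaleC: "c *\<^sub>C (d *\<^sub>C x) = (c * d) *\<^sub>C x"
    and scaleC_one: "1 *\<^sub>C x = x"
    and scaleR_scaleC: "r *\<^sub>R x = complex_of_real r *\<^sub>C x"

class complex_normed_vector = complex_vector + real_normed_vector +
  assumes norm_scaleC: "norm (c *\<^sub>C x) = cmod c * norm x"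

text \<open>Through \<open>real_normed_algebra_1\<close> the algebras of this class are unital and nonzero.\<close>

class cstar_algebra = complex_normed_vector + real_normed_algebra_1 + banach +
  fixes star :: "'a \<Rightarrow> 'a"
  assumes scaleC_mult_left: "(c *\<^sub>C x) * y = c *\<^sub>C (x * y)"
    and scaleC_mult_right: "x * (c *\<^sub>C y) = c *\<^sub>C (x * y)"
    and star_star: "star (star x) = x"
    and star_add: "star (x + y) = star x + star y"
    and star_scaleC: "star (c *\<^sub>C x) = cnj c *\<^sub>C star x"
    and star_mult: "star (x * y) = star y * star x"
    and cstar_identity: "norm (star x * x) = (norm x)\<^sup>2"

class complex_hilbert_space = complex_normed_vector + banach +
  fixes cinner :: "'a \<Rightarrow> 'a \<Rightarrow> complex"
  assumes cinner_add_left: "cinner (x + y) z = cinner x z + cinner y z"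
    and cinner_scaleC_left: "cinner (c *\<^sub>C x) y = c * cinner x y"
    and cinner_commute: "cinner y x = cnj (cinner x y)"
    and cinner_self: "cinner x x = complex_of_real ((norm x)\<^sup>2)"

instantiation complex :: cstar_algebra
begin

definition scaleC_complex :: "complex \<Rightarrow> complex \<Rightarrow> complex"
  where "scaleC_complex c x = c * x"

definition star_complex :: "complex \<Rightarrow> complex"
  where "star_complex = cnj"

instance
  by standard
    (auto simp: scaleC_complex_def star_complex_def algebra_simps norm_mult
      scaleR_conv_of_real power2_eq_square)

end

definition bounded_clinear :: "('a::complex_normed_vector \<Rightarrow> 'b::complex_normed_vector) \<Rightarrow> bool"
  where "bounded_clinear f \<longleftrightarrow> bounded_linear f \<and> (\<forall>c x. f (c *\<^sub>C x) = c *\<^sub>C f x)"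

definition unital_star_hom :: "('a::cstar_algebra \<Rightarrow> 'b::cstar_algebra) \<Rightarrow> bool"
  where "unital_star_hom f \<longleftrightarrow>
    (\<forall>x y. f (x + y) = f x + f y) \<and> (\<forall>c x. f (c *\<^sub>C x) = c *\<^sub>C f x) \<and>
    (\<forall>x y. f (x * y) = f x * f y) \<and> (\<forall>x. f (star x) = star (f x)) \<and> f 1 = 1"

definition star_isomorphism :: "('a::cstar_algebra \<Rightarrow> 'b::cstar_algebra) \<Rightarrow> bool"
  where "star_isomorphism f \<longleftrightarrow> unital_star_hom f \<and> bij f"

definition cstar_isomorphic :: "'a::cstar_algebra itself \<Rightarrow> 'b::cstar_algebra itself \<Rightarrow> bool"
  where "cstar_isomorphic _ _ \<longleftrightarrow> (\<exists>f :: 'a \<Rightarrow> 'b. star_isomorphism f)"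

definition closed_ideal :: "'a::cstar_algebra set \<Rightarrow> bool"
  where "closed_ideal I \<longleftrightarrow> closed I \<and> 0 \<in> I \<and> (\<forall>x\<in>I. \<forall>y\<in>I. x + y \<in> I) \<and>
    (\<forall>a. \<forall>x\<in>I. a * x \<in> I \<and> x * a \<in> I)"

definition simple_cstar :: "'a::cstar_algebra itself \<Rightarrow> bool"
  where "simple_cstar _ \<longleftrightarrow> (\<forall>I :: 'a set. closed_ideal I \<longrightarrow> I = {0} \<or> I = UNIV)"

definition is_state :: "('a::cstar_algebra \<Rightarrow> complex) \<Rightarrow> bool"
  where "is_state \<phi> \<longleftrightarrow>
    bounded_clinear \<phi> \<and> (\<forall>x. \<phi> (star x * x) \<in> \<real>\<^sub>\<ge>\<^sub>0) \<and> onorm \<phi> = 1"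

definition is_trace :: "('a::cstar_algebra \<Rightarrow> complex) \<Rightarrow> bool"
  where "is_trace \<tau> \<longleftrightarrow> is_state \<tau> \<and> (\<forall>x y. \<tau> (x * y) = \<tau> (y * x))"


section \<open>Infinite minimal tensor powers\<close>

text \<open>
  The minimal (spatial) norm on the algebraic tensor power of \<open>A\<close> over a finite set \<open>F\<close> is the
  operator norm in the tensor power of the universal representation of \<open>A\<close>, the direct
  sum of the GNS representations of all states. That tensor power is the direct sum, over all
  families \<open>\<phi> = (\<phi> g)\<close> of states indexed by \<open>g \<in> F\<close>, of the tensor products of the GNS
  representations of the \<open>\<phi> g\<close>; these act on the Hilbert space tensor product of the GNS spaces,
  in which the classes of finite sums of elementary tensors \<open>\<Otimes>g\<in>F. s i g\<close>, \<open>i \<in> I\<close>, are dense.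
  The norm of such a vector is \<open>gns_tensor_norm \<phi> F I s\<close>, since the inner product of two elementary
  tensors is the product of the numbers \<open>\<phi> g (star (s i g) * s j g)\<close>.
\<close>

definition gns_tensor_norm ::
  "('g \<Rightarrow> 'a::cstar_algebra \<Rightarrow> complex) \<Rightarrow> 'g set \<Rightarrow> 'i set \<Rightarrow> ('i \<Rightarrow> 'g \<Rightarrow> 'a) \<Rightarrow> real"
  where "gns_tensor_norm \<phi> F I s =
    sqrt (Re (\<Sum>i\<in>I. \<Sum>j\<in>I. \<Prod>g\<in>F. \<phi> g (star (s i g) * s j g)))"

text \<open>
  The minimal norm of \<open>\<Sum>k<n. \<Otimes>g\<in>F. a k g\<close>. Applying this operator to the vector
  \<open>\<Sum>j<p. \<Otimes>g\<in>F. s j g\<close> gives the sum of all \<open>\<Otimes>g\<in>F. a k g * s j g\<close>. The supremum is taken in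
  \<open>ereal\<close> so that its value does not depend on a boundedness proof.
\<close>

definition min_tensor_norm :: "'g set \<Rightarrow> nat \<Rightarrow> (nat \<Rightarrow> 'g \<Rightarrow> 'a::cstar_algebra) \<Rightarrow> ereal"
  where "min_tensor_norm F n a =
    Sup {ereal (gns_tensor_norm \<phi> F ({..<n} \<times> {..<p}) (\<lambda>(k, j) g. a k g * s j g)) | \<phi> p s.
      (\<forall>g. is_state (\<phi> g)) \<and> gns_tensor_norm \<phi> F {..<p::nat} s \<le> 1}"

text \<open>
  If \<open>\<iota> g\<close> embeds the algebra as the tensor factor at position \<open>g\<close>, and \<open>gs\<close> enumerates the finite
  set \<open>F\<close> without repetition, this is the image of \<open>\<Sum>k<n. \<Otimes>g\<in>F. a k g\<close>. The order of \<open>gs\<close> does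
  not matter once different factors commute.
\<close>

definition tensor_sum ::
  "('g \<Rightarrow> 'a::cstar_algebra \<Rightarrow> 'b::cstar_algebra) \<Rightarrow> 'g list \<Rightarrow> nat \<Rightarrow> (nat \<Rightarrow> 'g \<Rightarrow> 'a) \<Rightarrow> 'b"
  where "tensor_sum \<iota> gs n a = (\<Sum>k<n. prod_list (map (\<lambda>g. \<iota> g (a k g)) gs))"

text \<open>
  The algebra \<open>'b\<close>, together with the factor embeddings \<open>\<iota>\<close>, is the inductive limit of the minimal
  tensor powers of \<open>'a\<close> over the finite subsets \<open>F\<close> of \<open>'g\<close>: for each \<open>F\<close> the algebraic tensor power
  over \<open>F\<close> is mapped isometrically (for the minimal norm) and *-homomorphically into \<open>'b\<close>, so that
  its completion is a subalgebra of \<open>'b\<close>; enlarging \<open>F\<close> amounts to tensoring with units because each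
  \<open>\<iota> g\<close> is unital; and the union of these subalgebras is dense. This determines \<open>('b, \<iota>)\<close> uniquely up
  to isomorphism.
\<close>

definition infinite_min_tensor_power ::
  "('g \<Rightarrow> 'a::cstar_algebra \<Rightarrow> 'b::cstar_algebra) \<Rightarrow> bool"
  where "infinite_min_tensor_power \<iota> \<longleftrightarrow>
    (\<forall>g. unital_star_hom (\<iota> g)) \<and>
    (\<forall>g h a b. g \<noteq> h \<longrightarrow> \<iota> g a * \<iota> h b = \<iota> h b * \<iota> g a) \<and>
    (\<forall>gs n a. distinct gs \<longrightarrow> ereal (norm (tensor_sum \<iota> gs n a)) = min_tensor_norm (set gs) n a) \<and>
    closure {tensor_sum \<iota> gs n a | gs n a. distinct gs} = UNIV"


section \<open>Group actions and strong outerness\<close>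

definition cstar_action :: "('g::group_add \<Rightarrow> 'c::cstar_algebra \<Rightarrow> 'c) \<Rightarrow> bool"
  where "cstar_action \<alpha> \<longleftrightarrow> (\<forall>g. star_isomorphism (\<alpha> g)) \<and> \<alpha> 0 = id \<and>
    (\<forall>g h. \<alpha> (g + h) = \<alpha> g \<circ> \<alpha> h)"

definition bernoulli_action ::
  "('g::group_add \<Rightarrow> 'a::cstar_algebra \<Rightarrow> 'b::cstar_algebra) \<Rightarrow> ('g \<Rightarrow> 'b \<Rightarrow> 'b) \<Rightarrow> bool"
  where "bernoulli_action \<iota> \<sigma> \<longleftrightarrow>
    cstar_action \<sigma> \<and> (\<forall>g h a. \<sigma> g (\<iota> h a) = \<iota> (g + h) a)"

definition adjoint_pair :: "('h::complex_hilbert_space \<Rightarrow> 'h) \<Rightarrow> ('h \<Rightarrow> 'h) \<Rightarrow> bool"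
  where "adjoint_pair S T \<longleftrightarrow> (\<forall>x y. cinner (S x) y = cinner x (T y))"

definition unitary_op :: "('h::complex_hilbert_space \<Rightarrow> 'h) \<Rightarrow> bool"
  where "unitary_op W \<longleftrightarrow>
    bounded_clinear W \<and> surj W \<and> (\<forall>x y. cinner (W x) (W y) = cinner x y)"

definition commutant :: "('h::complex_hilbert_space \<Rightarrow> 'h) set \<Rightarrow> ('h \<Rightarrow> 'h) set"
  where "commutant S = {T. bounded_clinear T \<and> (\<forall>X\<in>S. T \<circ> X = X \<circ> T)}"

definition star_representation :: "('c::cstar_algebra \<Rightarrow> 'h::complex_hilbert_space \<Rightarrow> 'h) \<Rightarrow> bool"
  where "star_representation \<pi> \<longleftrightarrow>
    (\<forall>a. bounded_clinear (\<pi> a)) \<and>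
    (\<forall>a b v. \<pi> (a + b) v = \<pi> a v + \<pi> b v) \<and> (\<forall>c a v. \<pi> (c *\<^sub>C a) v = c *\<^sub>C \<pi> a v) \<and>
    (\<forall>a b. \<pi> (a * b) = \<pi> a \<circ> \<pi> b) \<and> (\<forall>a. adjoint_pair (\<pi> a) (\<pi> (star a))) \<and> \<pi> 1 = id"

text \<open>The GNS representation, with its cyclic vector; unique up to unitary equivalence.\<close>

definition gns_representation ::
  "('c::cstar_algebra \<Rightarrow> complex) \<Rightarrow> ('c \<Rightarrow> 'h::complex_hilbert_space \<Rightarrow> 'h) \<Rightarrow> 'h \<Rightarrow> bool"
  where "gns_representation \<tau> \<pi> \<xi> \<longleftrightarrow> star_representation \<pi> \<and>
    closure (range (\<lambda>a. \<pi> a \<xi>)) = UNIV \<and> (\<forall>a. \<tau> a = cinner (\<pi> a \<xi>) \<xi>)"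

definition generated_vn_algebra ::
  "('c::cstar_algebra \<Rightarrow> 'h::complex_hilbert_space \<Rightarrow> 'h) \<Rightarrow> ('h \<Rightarrow> 'h) set"
  where "generated_vn_algebra \<pi> = commutant (commutant (range \<pi>))"

text \<open>Only the values of the automorphism \<open>\<beta>\<close> on \<open>M\<close> are relevant in the next three definitions.\<close>

definition vn_automorphism ::
  "('h::complex_hilbert_space \<Rightarrow> 'h) set \<Rightarrow> (('h \<Rightarrow> 'h) \<Rightarrow> ('h \<Rightarrow> 'h)) \<Rightarrow> bool"
  where "vn_automorphism M \<beta> \<longleftrightarrow> bij_betw \<beta> M M \<and>
    (\<forall>x\<in>M. \<forall>y\<in>M. \<beta> (\<lambda>v. x v + y v) = (\<lambda>v. \<beta> x v + \<beta> y v)) \<and>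
    (\<forall>c. \<forall>x\<in>M. \<beta> (\<lambda>v. c *\<^sub>C x v) = (\<lambda>v. c *\<^sub>C \<beta> x v)) \<and>
    (\<forall>x\<in>M. \<forall>y\<in>M. \<beta> (x \<circ> y) = \<beta> x \<circ> \<beta> y) \<and>
    (\<forall>x\<in>M. \<forall>y\<in>M. adjoint_pair x y \<longrightarrow> adjoint_pair (\<beta> x) (\<beta> y))"

definition vn_extension ::
  "('c::cstar_algebra \<Rightarrow> 'h::complex_hilbert_space \<Rightarrow> 'h) \<Rightarrow> ('c \<Rightarrow> 'c) \<Rightarrow>
    (('h \<Rightarrow> 'h) \<Rightarrow> ('h \<Rightarrow> 'h)) \<Rightarrow> bool"
  where "vn_extension \<pi> \<theta> \<beta> \<longleftrightarrow>
    vn_automorphism (generated_vn_algebra \<pi>) \<beta> \<and> (\<forall>a. \<beta> (\<pi> a) = \<pi> (\<theta> a))"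

text \<open>For a unitary \<open>W\<close> the adjoint is \<open>inv W\<close>.\<close>

definition outer_automorphism ::
  "('h::complex_hilbert_space \<Rightarrow> 'h) set \<Rightarrow> (('h \<Rightarrow> 'h) \<Rightarrow> ('h \<Rightarrow> 'h)) \<Rightarrow> bool"
  where "outer_automorphism M \<beta> \<longleftrightarrow>
    \<not> (\<exists>W\<in>M. unitary_op W \<and> (\<forall>x\<in>M. \<beta> x = W \<circ> x \<circ> inv W))"

text \<open>
  HOL cannot quantify over types, so the type \<open>'h\<close> on which the GNS representations are realised is a
  parameter; strong outerness is the conjunction of these statements over all \<open>'h\<close>, that is, the
  statement with \<open>'h\<close> a free type variable. The extension of \<open>\<alpha> g\<close> to the generated von Neumann
  algebra is unique, as automorphisms of von Neumann algebras are normal; requiring both existence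
  and outerness of every extension avoids depending on this fact.
\<close>

definition strongly_outer ::
  "'h::complex_hilbert_space itself \<Rightarrow> ('g::group_add \<Rightarrow> 'c::cstar_algebra \<Rightarrow> 'c) \<Rightarrow> bool"
  where "strongly_outer _ \<alpha> \<longleftrightarrow>
    cstar_action \<alpha> \<and> (\<exists>\<tau> :: 'c \<Rightarrow> complex. is_trace \<tau>) \<and>
    (\<forall>g \<tau> \<pi> (\<xi> :: 'h). g \<noteq> 0 \<longrightarrow> is_trace \<tau> \<longrightarrow> \<tau> \<circ> \<alpha> g = \<tau> \<longrightarrow> gns_representation \<tau> \<pi> \<xi> \<longrightarrow>
      (\<exists>\<beta>. vn_extension \<pi> (\<alpha> g) \<beta>) \<and>
      (\<forall>\<beta>. vn_extension \<pi> (\<alpha> g) \<beta> \<longrightarrow> outer_automorphism (generated_vn_algebra \<pi>) \<beta>))"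

end

theory Submission
  imports Defs
begin

text \<open>
  Fix a nontrivial group element \<open>g\<close>, an invariant trace \<open>t\<close> on the tensor power and its GNS
  representation \<open>\<pi>\<close> with cyclic vector \<open>\<xi>\<close>. Because \<open>t\<close> is invariant, \<open>\<sigma> g\<close> is implemented by a unitary
  on the GNS space, and conjugation with this unitary is the extension of \<open>\<sigma> g\<close> to the von Neumann algebra
  \<open>M\<close> generated by \<open>\<pi>\<close> (\<open>invariant_extension_exists\<close>).

  Outerness comes from asymptotic commutation. Suppose that a unitary \<open>W\<close> in \<open>M\<close> implements \<open>\<sigma> g\<close>. In the
  norm of the GNS space, \<open>W\<close> is approximated by an element \<open>c\<close> supported on finitely many positions,
  so \<open>W\<close> almost commutes with the copy \<open>\<iota> h a\<close> of any fixed \<open>a\<close> at a position \<open>h\<close> outside that finite set. But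
  \<open>W\<close> also moves \<open>\<iota> h a\<close> to \<open>\<iota> (g + h) a\<close>, which is far away from \<open>\<iota> h a\<close> if \<open>a\<close> is a nonzero
  element of trace zero: in every trace on the tensor power the two copies are orthogonal to each other,
  and both are independent of \<open>c\<close>. The position \<open>h\<close> exists because the group is infinite. This is
  \<open>no_implementing_isometry\<close>. That \<open>W\<close> belongs to \<open>M\<close> is used in the form that \<open>W\<close> commutes with
  the right multiplications, which are bounded because \<open>t\<close> is a trace.

  The hypotheses on \<open>A\<close> enter as follows. As \<open>A\<close> is not \<open>\<complex>\<close>, it has a nonzero element of trace zero
  (\<open>nonzero_element_of_trace_zero\<close>). Simplicity makes the trace faithful, so this element has positive length
  (\<open>trace_faithful\<close>). Uniqueness of the trace gives the independence of the tensor factors with respect to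
  an arbitrary trace \<open>t\<close> (\<open>trace_factor_independent\<close>): for \<open>y\<close> commuting with the factor at \<open>h\<close>, the
  functional \<open>a \<mapsto> t (star y * y * \<iota> h a)\<close> is positive and tracial, hence a multiple of the trace of \<open>A\<close>.

  That the tensor power has a trace at all is a separate matter (\<open>product_trace_exists\<close>). The product trace on
  finite sums of elementary tensors is positive by the Schur product theorem, and it is contractive for the
  minimal norm because this norm can be tested on the unit vector of the product of GNS spaces.
\<close>

section \<open>Elementary facts on scalars and the involution\<close>

lemma scaleC_zero_right [simp]: "c *\<^sub>C (0 :: 'a::complex_vector) = 0"
  using scaleC_add_right[of c "0::'a" 0] by simp

lemma scaleC_zero_left [simp]: "0 *\<^sub>C (x :: 'a::complex_vector) = 0"
  using scaleC_add_left[of 0 0 x] by simp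

lemma scaleC_minus_left [simp]: "(- c) *\<^sub>C (x :: 'a::complex_vector) = - (c *\<^sub>C x)"
  using scaleC_add_left[of c "-c" x] by (simp add: eq_neg_iff_add_eq_0 add.commute)

lemma scaleC_sum_right: "c *\<^sub>C (\<Sum>i\<in>I. f i :: 'a::complex_vector) = (\<Sum>i\<in>I. c *\<^sub>C f i)"
  by (induction I rule: infinite_finite_induct) (auto simp: scaleC_add_right)

declare scaleC_one [simp] star_star [simp]

lemma star_zero [simp]: "star (0 :: 'a::cstar_algebra) = 0"
  using star_add[of "0::'a" 0] by simp

lemma star_minus [simp]: "star (- x :: 'a::cstar_algebra) = - star x"
  using star_add[of x "-x"] by (simp add: eq_neg_iff_add_eq_0 add.commute)

lemma star_diff: "star (x - y :: 'a::cstar_algebra) = star x - star y"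
  using star_add[of x "-y"] by simp

lemma star_one [simp]: "star (1 :: 'a::cstar_algebra) = 1"
proof -
  have "star (1 :: 'a) = star (star 1) * star 1" by (simp only: star_star mult_1)
  also have "\<dots> = star (1 * star 1)" by (simp only: star_mult)
  also have "\<dots> = 1" by simp
  finally show ?thesis .
qed

lemma star_sum: "star (\<Sum>i\<in>I. f i :: 'a::cstar_algebra) = (\<Sum>i\<in>I. star (f i))"
  by (induction I rule: infinite_finite_induct) (auto simp: star_add)

lemma norm_star [simp]: "norm (star x :: 'a::cstar_algebra) = norm x"
proof -
  have "norm y \<le> norm (star y)" for y :: 'a
  proof (cases "y = 0")
    case False
    have "(norm y)\<^sup>2 \<le> norm (star y) * norm y"
      using norm_mult_ineq[of "star y" y] by (simp add: cstar_identity)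
    then show ?thesis using False by (simp add: power2_eq_square)
  qed simp
  from this[of x] this[of "star x"] show ?thesis by simp
qed

lemma bounded_linear_star: "bounded_linear (star :: 'a::cstar_algebra \<Rightarrow> 'a)"
  by (rule bounded_linear_intro[of _ 1]) (auto simp: star_add scaleR_scaleC star_scaleC)

lemmas continuous_on_star [continuous_intros] =
  bounded_linear.continuous_on[OF bounded_linear_star]

lemma bounded_clinearD:
  assumes "bounded_clinear f"
  shows "bounded_linear f" "f (x + y) = f x + f y" "f (c *\<^sub>C x) = c *\<^sub>C f x"
    "f (x - y) = f x - f y" "f 0 = 0" "f (- x) = - f x" "continuous_on S f"
    "f (sum h I) = (\<Sum>i\<in>I. f (h i))"
proof -
  interpret bounded_linear f using assms by (simp add: bounded_clinear_def)
  show "bounded_linear f" "f (x + y) = f x + f y" "f (x - y) = f x - f y" "f 0 = 0"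
    "f (- x) = - f x" "f (sum h I) = (\<Sum>i\<in>I. f (h i))" "continuous_on S f"
    by (auto simp: add diff zero neg sum intro: linear_continuous_on bounded_linear_axioms)
  show "f (c *\<^sub>C x) = c *\<^sub>C f x" using assms by (simp add: bounded_clinear_def)
qed

lemma bounded_clinearI:
  assumes "\<And>x y. f (x + y) = f x + f y" "\<And>c x. f (c *\<^sub>C x) = c *\<^sub>C f x"
    "\<And>x. norm (f x) \<le> norm x * K"
  shows "bounded_clinear f"
  unfolding bounded_clinear_def
  using assms by (auto intro!: bounded_linear_intro[of f K] simp: scaleR_scaleC)

lemma bounded_clinear_compose:
  assumes "bounded_clinear f" "bounded_clinear g"
  shows "bounded_clinear (f \<circ> g)"
  using assms unfolding bounded_clinear_def o_def by (auto intro: bounded_linear_compose)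

lemma unital_star_homD:
  assumes "unital_star_hom f"
  shows "f (x + y) = f x + f y" "f (c *\<^sub>C x) = c *\<^sub>C f x" "f (x * y) = f x * f y"
    "f (star x) = star (f x)" "f 1 = 1"
  using assms by (auto simp: unital_star_hom_def)

section \<open>Positive functionals\<close>

definition positive_functional :: "('a::cstar_algebra \<Rightarrow> complex) \<Rightarrow> bool"
  where "positive_functional \<omega> \<longleftrightarrow> bounded_clinear \<omega> \<and> (\<forall>x. \<omega> (star x * x) \<in> \<real>\<^sub>\<ge>\<^sub>0)"

context
  fixes \<omega> :: "'a::cstar_algebra \<Rightarrow> complex"
  assumes pos: "positive_functional \<omega>"
begin

lemma pos_functional_linear:
  "\<omega> (x + y) = \<omega> x + \<omega> y" "\<omega> (x - y) = \<omega> x - \<omega> y" "\<omega> (c *\<^sub>C x) = c * \<omega> x"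
  "\<omega> (- x) = - \<omega> x" "\<omega> 0 = 0" "bounded_linear \<omega>"
  using pos bounded_clinearD[of \<omega>]
  by (auto simp: positive_functional_def scaleC_complex_def)

lemma pos_functional_square:
  "Im (\<omega> (star x * x)) = 0" "Re (\<omega> (star x * x)) \<ge> 0"
  using pos by (auto simp: positive_functional_def complex_nonneg_Reals_iff)

text \<open>
  The values of \<open>\<omega>\<close> on the squares of \<open>x + y\<close> and \<open>x + \<i>y\<close> are real; comparing imaginary
  parts gives both components of the equation.
\<close>

lemma pos_functional_hermitian: "\<omega> (star x * y) = cnj (\<omega> (star y * x))"
proof -
  have "Im (\<omega> (star (x + y) * (x + y))) = 0" "Im (\<omega> (star (x + \<i> *\<^sub>C y) * (x + \<i> *\<^sub>C y))) = 0"
    by (rule pos_functional_square)+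
  then show ?thesis
    using pos_functional_square(1)[of x] pos_functional_square(1)[of y]
    by (auto simp: star_add star_scaleC algebra_simps scaleC_mult_left scaleC_mult_right
        pos_functional_linear scaleC_scaleC complex_eq_iff)
qed

lemma pos_functional_Cauchy_Schwarz:
  "(cmod (\<omega> (star x * y)))\<^sup>2 \<le> Re (\<omega> (star x * x)) * Re (\<omega> (star y * y))"
proof -
  define A B C where "A = Re (\<omega> (star x * x))" and "B = \<omega> (star x * y)" and "C = Re (\<omega> (star y * y))"
  have nonneg: "A \<ge> 0" "C \<ge> 0" using pos_functional_square by (auto simp: A_def C_def)
  have xx: "\<omega> (star x * x) = of_real A" and yy: "\<omega> (star y * y) = of_real C"
    using pos_functional_square by (auto simp: A_def C_def complex_eq_iff)
  have yx: "\<omega> (star y * x) = cnj B" unfolding B_def by (rule pos_functional_hermitian)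
  \<comment> \<open>Positivity at \<open>y - tBx\<close>. The choice \<open>t = 1/A\<close> is optimal; if \<open>A = 0\<close>, a large \<open>t\<close> forces \<open>B = 0\<close>.\<close>
  have main: "C - 2 * t * (cmod B)\<^sup>2 + t\<^sup>2 * (cmod B)\<^sup>2 * A \<ge> 0" for t :: real
  proof -
    define l where "l = of_real t * B"
    have "\<omega> (star (y - l *\<^sub>C x) * (y - l *\<^sub>C x))
        = of_real C - l * cnj B - cnj l * B + cnj l * l * of_real A"
      by (simp add: star_diff star_scaleC algebra_simps scaleC_mult_left scaleC_mult_right
        pos_functional_linear scaleC_scaleC xx yy yx flip: B_def)
    also have "\<dots> = of_real (C - 2 * t * (cmod B)\<^sup>2 + t\<^sup>2 * (cmod B)\<^sup>2 * A)"
      unfolding l_def by (simp add: complex_norm_square algebra_simps power2_eq_square[of t] flip: of_real_power)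
    finally show ?thesis using pos_functional_square(2)[of "y - l *\<^sub>C x"] by simp
  qed
  show ?thesis
  proof (cases "A = 0")
    case True
    have "(cmod B)\<^sup>2 = 0"
    proof (rule ccontr)
      assume *: "(cmod B)\<^sup>2 \<noteq> 0"
      then show False using main[of "(C + 1) / (2 * (cmod B)\<^sup>2)"] True by simp
    qed
    then show ?thesis using True by (simp add: B_def A_def)
  next
    case False
    then have "A > 0" using nonneg by simp
    then show ?thesis using main[of "1 / A"]
      by (simp add: A_def[symmetric] B_def[symmetric] C_def[symmetric] field_simps power2_eq_square)
  qed
qed

lemma pos_functional_one: "\<omega> 1 = of_real (Re (\<omega> 1))" "Re (\<omega> 1) \<ge> 0"
  using pos_functional_square[of 1] by (auto simp: complex_eq_iff)

text \<open>
  Usually this is read off from the positivity of \<open>\<parallel>x\<parallel>\<^sup>2 - star x * x\<close>, which needs the functional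
  calculus. Instead the Cauchy-Schwarz inequality against \<open>1\<close> is iterated along the powers
  \<open>h ^ (2 ^ n)\<close> of the self-adjoint element \<open>h = star x * x\<close>: it bounds \<open>\<bar>\<omega> h\<bar> ^ (2 ^ n)\<close> by
  \<open>\<omega> 1 ^ (2 ^ n - 1) * K * \<parallel>h\<parallel> ^ (2 ^ n)\<close>, where \<open>K\<close> is any bound of \<open>\<omega>\<close>, and the constant \<open>K\<close> disappears
  when the root of order \<open>2 ^ n\<close> is taken.
\<close>

lemma pos_functional_norm_bound: "Re (\<omega> (star x * x)) \<le> Re (\<omega> 1) * (norm x)\<^sup>2"
proof -
  define h M where "h = star x * x" and "M = Re (\<omega> 1)"
  define r where "r = cmod (\<omega> h)"
  obtain K where K: "K > 0" "\<And>z. cmod (\<omega> z) \<le> norm z * K"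
    using bounded_linear.pos_bounded[OF pos_functional_linear(6)] by blast
  have M: "M \<ge> 0" unfolding M_def by (rule pos_functional_one)
  have power_star: "star (h ^ n) = h ^ n" for n
    by (induction n) (auto simp: star_mult h_def power_commutes)
  have CS: "(cmod (\<omega> (h ^ n)))\<^sup>2 \<le> M * cmod (\<omega> (h ^ (2 * n)))" for n
  proof -
    have "(cmod (\<omega> (h ^ n)))\<^sup>2 \<le> M * Re (\<omega> (h ^ (2 * n)))"
      using pos_functional_Cauchy_Schwarz[of 1 "h ^ n"]
      by (simp add: power_star M_def mult_2 power_add)
    also have "\<dots> \<le> M * cmod (\<omega> (h ^ (2 * n)))"
      using M by (intro mult_left_mono complex_Re_le_cmod)
    finally show ?thesis .
  qed
  \<comment> \<open>The factor \<open>M\<close> on the left avoids the exponent \<open>2 ^ n - 1\<close> on the right.\<close>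
  have iter: "r ^ (2 ^ n) * M \<le> M ^ (2 ^ n) * cmod (\<omega> (h ^ (2 ^ n)))" for n
  proof (induction n)
    case (Suc n)
    show ?case
    proof (cases "M = 0")
      case False
      with M have "M > 0" by simp
      have "r ^ (2 ^ n) * M \<ge> 0" using M by (simp add: r_def)
      then have "(r ^ (2 ^ n) * M)\<^sup>2 \<le> (M ^ (2 ^ n) * cmod (\<omega> (h ^ (2 ^ n))))\<^sup>2"
        using Suc by (rule power_mono[rotated])
      also have "\<dots> = (M ^ (2 ^ n))\<^sup>2 * (cmod (\<omega> (h ^ (2 ^ n))))\<^sup>2" by (rule power_mult_distrib)
      also have "\<dots> \<le> (M ^ (2 ^ n))\<^sup>2 * (M * cmod (\<omega> (h ^ (2 * 2 ^ n))))"
        by (intro mult_left_mono CS) simp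
      finally have "r ^ (2 ^ Suc n) * M * M \<le> M ^ (2 ^ Suc n) * cmod (\<omega> (h ^ (2 ^ Suc n))) * M"
        by (simp add: power_mult_distrib power2_eq_square power_mult power_add mult_2 algebra_simps)
      then show ?thesis using \<open>M > 0\<close> by simp
    qed simp
  qed (simp add: r_def)
  have "r \<le> M * norm h"
  proof (cases "M = 0")
    case True
    then show ?thesis using CS[of 1] by (simp add: r_def)
  next
    case False
    then have "M > 0" using M by simp
    show ?thesis
    proof (rule ccontr)
      assume less: "\<not> r \<le> M * norm h"
      have "norm h > 0 \<or> h = 0" by auto
      moreover have "h \<noteq> 0" using less by (auto simp: r_def pos_functional_linear)
      ultimately have "norm h > 0" by simp
      define q where "q = r / (M * norm h)"
      have "q > 1" using less \<open>M > 0\<close> \<open>norm h > 0\<close> by (simp add: q_def field_simps)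
      have bound: "q ^ (2 ^ n) * M \<le> K" for n
      proof -
        have "r ^ (2 ^ n) * M \<le> M ^ (2 ^ n) * cmod (\<omega> (h ^ (2 ^ n)))" by (rule iter)
        also have "\<dots> \<le> M ^ (2 ^ n) * (norm (h ^ (2 ^ n)) * K)"
          using M by (intro mult_left_mono K) simp
        also have "\<dots> \<le> M ^ (2 ^ n) * (norm h ^ (2 ^ n) * K)"
          using M K by (intro mult_left_mono mult_right_mono norm_power_ineq) auto
        finally show ?thesis
          using \<open>M > 0\<close> \<open>norm h > 0\<close> by (simp add: q_def power_divide power_mult_distrib field_simps)
      qed
      obtain n where n: "K / M < q ^ n" using real_arch_pow[OF \<open>q > 1\<close>] by blast
      have "q ^ n \<le> q ^ (2 ^ n)" using \<open>q > 1\<close> by (intro power_increasing) auto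
      then have "q ^ n * M \<le> q ^ (2 ^ n) * M" using \<open>M > 0\<close> by simp
      moreover have "K < q ^ n * M" using n \<open>M > 0\<close> by (simp add: field_simps)
      ultimately show False using bound[of n] by linarith
    qed
  qed
  then show ?thesis
    using complex_Re_le_cmod[of "\<omega> h"]
    by (simp add: r_def h_def M_def cstar_identity)
qed

lemma pos_functional_cmod_bound: "cmod (\<omega> x) \<le> Re (\<omega> 1) * norm x"
proof (rule power2_le_imp_le)
  have "(cmod (\<omega> x))\<^sup>2 \<le> Re (\<omega> 1) * Re (\<omega> (star x * x))"
    using pos_functional_Cauchy_Schwarz[of 1 x] by simp
  also have "\<dots> \<le> Re (\<omega> 1) * (Re (\<omega> 1) * (norm x)\<^sup>2)"
    by (intro mult_left_mono pos_functional_norm_bound pos_functional_one)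
  finally show "(cmod (\<omega> x))\<^sup>2 \<le> (Re (\<omega> 1) * norm x)\<^sup>2" by (simp add: power2_eq_square algebra_simps)
qed (simp add: pos_functional_one(2))

lemma pos_functional_compress: "positive_functional (\<lambda>b. \<omega> (star c * b * c))"
  unfolding positive_functional_def
proof (intro conjI allI)
  have *: "bounded_linear (\<lambda>b. \<omega> (star c * b * c))"
    by (intro bounded_linear_compose[OF pos_functional_linear(6)]
        bounded_linear_compose[OF bounded_linear_mult_left] bounded_linear_mult_right)
  then show "bounded_clinear (\<lambda>b. \<omega> (star c * b * c))"
    by (auto simp: bounded_clinear_def scaleC_mult_left scaleC_mult_right pos_functional_linear
        scaleC_complex_def)
next
  fix x
  show "\<omega> (star c * (star x * x) * c) \<in> \<real>\<^sub>\<ge>\<^sub>0"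
    using pos unfolding positive_functional_def
    by (metis mult.assoc star_mult)
qed

end

text \<open>
  This is the statement that left multiplication by \<open>b\<close> acts on the GNS space of \<open>\<omega>\<close> with norm at
  most that of \<open>b\<close>. It is the norm bound for the functional \<open>b \<mapsto> \<omega> (star c * b * c)\<close>.
\<close>

lemma pos_functional_mult_bound:
  assumes "positive_functional \<omega>"
  shows "Re (\<omega> (star (b * c) * (b * c))) \<le> (norm b)\<^sup>2 * Re (\<omega> (star c * c))"
  using pos_functional_norm_bound[OF pos_functional_compress[OF assms, of c], of b]
  by (simp add: star_mult mult.assoc mult.commute)

lemma state_positive: "is_state \<phi> \<Longrightarrow> positive_functional \<phi>"
  by (auto simp: is_state_def positive_functional_def)

lemma state_one: 
  assumes "is_state \<phi>"
  shows "\<phi> 1 = 1"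
proof -
  note pos = state_positive[OF assms]
  have "onorm \<phi> \<le> Re (\<phi> 1)"
    using pos_functional_cmod_bound[OF pos] pos_functional_one(2)[OF pos] by (intro onorm_bound) auto
  moreover have "cmod (\<phi> 1) \<le> onorm \<phi> * norm (1::'a)"
    by (intro onorm pos_functional_linear pos)
  ultimately have "Re (\<phi> 1) = 1"
    using assms complex_Re_le_cmod[of "\<phi> 1"] by (simp add: is_state_def)
  then show ?thesis using pos_functional_one(1)[OF pos] by (metis of_real_1)
qed

lemma is_stateI:
  assumes "positive_functional \<omega>" "\<omega> 1 = 1"
  shows "is_state \<omega>"
proof -
  have "cmod (\<omega> x) \<le> 1 * norm x" for x
    using pos_functional_cmod_bound[OF assms(1), of x] assms(2) by simp
  then have "onorm \<omega> \<le> 1" by (intro onorm_bound) simp_all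
  moreover have "cmod (\<omega> 1) \<le> onorm \<omega> * norm (1::'a)"
    by (intro onorm pos_functional_linear assms)
  ultimately have "onorm \<omega> = 1" using assms(2) by simp
  then show ?thesis using assms(1) by (simp add: is_state_def positive_functional_def)
qed

section \<open>Traces on simple algebras\<close>

text \<open>
  If \<open>\<omega> 1\<close> is not \<open>0\<close> then \<open>\<omega>\<close> can be normalised to a trace; otherwise \<open>\<omega>\<close> vanishes, because its norm
  is \<open>\<omega> 1\<close>.
\<close>

lemma unique_trace_scale:
  fixes \<tau> \<omega> :: "'a::cstar_algebra \<Rightarrow> complex"
  assumes uniq: "\<And>\<tau>'. is_trace \<tau>' \<Longrightarrow> \<tau>' = \<tau>"
    and pos: "positive_functional \<omega>" and tr: "\<And>x y. \<omega> (x * y) = \<omega> (y * x)"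
  shows "\<omega> x = \<omega> 1 * \<tau> x"
proof (cases "\<omega> 1 = 0")
  case True
  then show ?thesis using pos_functional_cmod_bound[OF pos, of x] by simp
next
  case False
  define M where "M = Re (\<omega> 1)"
  have M: "\<omega> 1 = of_real M"
    unfolding M_def by (rule pos_functional_one[OF pos])
  have M_pos: "M > 0"
    using pos_functional_one(2)[OF pos] False M by (auto simp: less_le simp flip: M_def)
  have "positive_functional (\<lambda>x. \<omega> x / \<omega> 1)"
    unfolding positive_functional_def
  proof (intro conjI allI)
    show "bounded_clinear (\<lambda>x. \<omega> x / \<omega> 1)"
      using pos_functional_linear[OF pos]
      by (auto simp: bounded_clinear_def scaleC_complex_def intro: bounded_linear_divide bounded_linear_compose)
    show "\<omega> (star x * x) / \<omega> 1 \<in> \<real>\<^sub>\<ge>\<^sub>0" for x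
      using pos_functional_square[OF pos, of x] M_pos
      by (auto simp: M complex_nonneg_Reals_iff)
  qed
  then have "is_trace (\<lambda>x. \<omega> x / \<omega> 1)"
    using is_stateI[of "\<lambda>x. \<omega> x / \<omega> 1"] False tr by (auto simp: is_trace_def)
  from fun_cong[OF uniq[OF this], of x] False show ?thesis by (simp add: field_simps)
qed

text \<open>
  The null space of the form \<open>\<tau> (star x * y)\<close> is a closed left ideal for every state, and the trace
  property makes it invariant under the involution, hence two-sided. It does not contain \<open>1\<close>.
\<close>

lemma trace_faithful:
  fixes \<tau> :: "'a::cstar_algebra \<Rightarrow> complex"
  assumes simple: "simple_cstar TYPE('a)" and tr: "is_trace \<tau>"
    and zero: "\<tau> (star x * x) = 0"
  shows "x = 0"
proof -
  have st: "is_state \<tau>" and comm: "\<And>x y. \<tau> (x * y) = \<tau> (y * x)"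
    using tr by (auto simp: is_trace_def)
  note pos = state_positive[OF st]
  define I where "I = {x. \<tau> (star x * x) = 0}"
  have I_iff: "x \<in> I \<longleftrightarrow> Re (\<tau> (star x * x)) \<le> 0" for x
    using pos_functional_square[OF pos, of x] by (auto simp: I_def complex_eq_iff)
  have left: "a * x \<in> I" if "x \<in> I" for a x
    using pos_functional_mult_bound[OF pos, of a x] that by (subst I_iff) (simp add: I_def)
  have star: "star x \<in> I" if "x \<in> I" for x
    using that comm[of x "star x"] by (simp add: I_def)
  have "closed_ideal I"
    unfolding closed_ideal_def
  proof (intro conjI ballI allI)
    show "closed I"
      unfolding I_def
      by (intro closed_Collect_eq continuous_intros
          bounded_linear.continuous_on[OF pos_functional_linear(6)[OF pos]])
    show "0 \<in> I" by (simp add: I_def pos_functional_linear[OF pos])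
    show "x + y \<in> I" if "x \<in> I" "y \<in> I" for x y
      using that pos_functional_Cauchy_Schwarz[OF pos, of x y] pos_functional_Cauchy_Schwarz[OF pos, of y x]
      by (simp add: I_def star_add algebra_simps pos_functional_linear[OF pos])
    show "a * x \<in> I" if "x \<in> I" for a x using left[OF that] .
    show "x * a \<in> I" if "x \<in> I" for a x
      using star[OF left[OF star[OF that], of "star a"]] by (simp add: star_mult)
  qed
  moreover have "1 \<notin> I" using state_one[OF st] by (simp add: I_def)
  ultimately have "I = {0}" using simple by (auto simp: simple_cstar_def)
  then show ?thesis using zero by (auto simp: I_def)
qed

text \<open>
  Here the algebra being different from \<open>\<complex>\<close> enters: if every \<open>a - \<tau> a *\<^sub>C 1\<close> vanished, then all elements would
  be scalars and \<open>\<tau>\<close> would be an isomorphism onto \<open>\<complex>\<close>.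
\<close>

lemma nonzero_element_of_trace_zero:
  fixes \<tau> :: "'a::cstar_algebra \<Rightarrow> complex"
  assumes st: "is_state \<tau>" and ni: "\<not> cstar_isomorphic TYPE('a) TYPE(complex)"
  obtains a where "\<tau> a = 0" "a \<noteq> 0"
proof -
  note pos = state_positive[OF st]
  have one: "\<tau> 1 = 1" by (rule state_one[OF st])
  have "\<exists>a. a \<noteq> \<tau> a *\<^sub>C 1"
  proof (rule ccontr)
    assume "\<nexists>a. a \<noteq> \<tau> a *\<^sub>C 1"
    then have eq: "a = \<tau> a *\<^sub>C 1" for a by blast
    have mult: "\<tau> (x * y) = \<tau> x * \<tau> y" for x y
      by (subst eq[of x]) (simp add: scaleC_mult_left pos_functional_linear[OF pos])
    have star: "\<tau> (star x) = cnj (\<tau> x)" for x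
      using pos_functional_hermitian[OF pos, of x 1] by simp
    have "bij \<tau>"
    proof (rule bijI)
      show "inj \<tau>" by (metis eq injI)
      show "surj \<tau>"
        by (rule surjI[of _ "\<lambda>c. c *\<^sub>C 1"]) (simp add: pos_functional_linear[OF pos] one)
    qed
    then have "star_isomorphism \<tau>"
      by (simp add: star_isomorphism_def unital_star_hom_def pos_functional_linear[OF pos] mult star one
          scaleC_complex_def star_complex_def)
    with ni show False by (auto simp: cstar_isomorphic_def)
  qed
  then obtain a where "a \<noteq> \<tau> a *\<^sub>C 1" by blast
  then show ?thesis
    by (intro that[of "a - \<tau> a *\<^sub>C 1"]) (simp_all add: pos_functional_linear[OF pos] one)
qed

section \<open>Positivity of product functionals\<close>

text \<open>
  Gram-Schmidt without a Hilbert space: for a new vector \<open>s i\<^sub>0\<close>, all other vectors are replaced by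
  their components orthogonal to it, and the components along it contribute one more summand. If
  \<open>s i\<^sub>0\<close> has length \<open>0\<close>, the convention \<open>x / 0 = 0\<close> makes this summand vanish, which is right by the
  Cauchy-Schwarz inequality.
\<close>

lemma pos_functional_Gram:
  assumes pos: "positive_functional \<phi>" and "finite I"
  shows "\<exists>(m::nat) v. \<forall>i\<in>I. \<forall>j\<in>I. \<phi> (star (s i) * s j) = (\<Sum>r<m. cnj (v r i) * v r j)"
  using \<open>finite I\<close>
proof (induction I arbitrary: s)
  case (insert i\<^sub>0 I)
  note lin = pos_functional_linear[OF pos]
  define p where "p j = \<phi> (star (s i\<^sub>0) * s j)" for j
  define q where "q = Re (p i\<^sub>0)"
  have q: "p i\<^sub>0 = of_real q" "q \<ge> 0"
    using pos_functional_square[OF pos, of "s i\<^sub>0"] by (auto simp: q_def p_def complex_eq_iff)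
  have p_cnj: "\<phi> (star (s j) * s i\<^sub>0) = cnj (p j)" for j
    unfolding p_def by (rule pos_functional_hermitian[OF pos])
  have p_zero: "p j = 0" if "q = 0" for j
    using pos_functional_Cauchy_Schwarz[OF pos, of "s i\<^sub>0" "s j"] that q by (simp add: p_def)
  define s' where "s' j = s j - (p j / of_real q) *\<^sub>C s i\<^sub>0" for j
  obtain m v where v: "\<And>i j. i \<in> I \<Longrightarrow> j \<in> I \<Longrightarrow> \<phi> (star (s' i) * s' j) = (\<Sum>r<(m::nat). cnj (v r i) * v r j)"
    using insert.IH[of s'] by blast
  have split: "\<phi> (star (s i) * s j) = \<phi> (star (s' i) * s' j) + cnj (p i) * p j / of_real q" for i j
  proof -
    have "\<phi> (star (s' i) * s' j) = \<phi> (star (s i) * s j) - p j / of_real q * cnj (p i)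
        - cnj (p i) / of_real q * p j + cnj (p i) / of_real q * (p j / of_real q) * p i\<^sub>0"
      by (simp add: s'_def star_diff star_scaleC algebra_simps scaleC_mult_left scaleC_mult_right lin
        scaleC_scaleC p_cnj p_def[symmetric] q(1) del: times_divide_eq_left times_divide_eq_right)
    moreover have "cnj (p i) / of_real q * (p j / of_real q) * p i\<^sub>0 = cnj (p i) * p j / of_real q"
      by (simp add: q(1))
    ultimately show ?thesis by (simp add: mult.commute)
  qed
  define w where
    "w r j = (if r < m then if j = i\<^sub>0 then 0 else v r j else p j / of_real (sqrt q))" for r j
  have sqrt: "complex_of_real (sqrt q) * complex_of_real (sqrt q) = of_real q"
    using q(2) by (simp flip: of_real_mult)
  have "\<phi> (star (s i) * s j) = (\<Sum>r<Suc m. cnj (w r i) * w r j)"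
    if "i \<in> insert i\<^sub>0 I" "j \<in> insert i\<^sub>0 I" for i j
  proof -
    have last: "cnj (w m i) * w m j = cnj (p i) * p j / of_real q"
      by (simp add: w_def sqrt)
    consider "i = i\<^sub>0" | "j = i\<^sub>0" | "i \<in> I" "j \<in> I" "i \<noteq> i\<^sub>0" "j \<noteq> i\<^sub>0"
      using \<open>i \<in> insert i\<^sub>0 I\<close> \<open>j \<in> insert i\<^sub>0 I\<close> insert.hyps by auto
    then show ?thesis
    proof cases
      case 1
      have "\<phi> (star (s i) * s j) = p j" using 1 by (simp add: p_def)
      also have "\<dots> = cnj (w m i) * w m j" unfolding last using p_zero by (cases "q = 0") (simp_all add: 1 q)
      finally show ?thesis using 1 by (simp add: w_def)
    next
      case 2
      have "\<phi> (star (s i) * s j) = cnj (p i)" using 2 by (simp add: p_cnj)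
      also have "\<dots> = cnj (w m i) * w m j" unfolding last using p_zero by (cases "q = 0") (simp_all add: 2 q)
      finally show ?thesis using 2 by (simp add: w_def)
    next
      case 3
      then show ?thesis by (simp only: sum.lessThan_Suc last split v) (simp add: w_def)
    qed
  qed
  then show ?case by blast
qed simp

definition psd_kernel :: "'i set \<Rightarrow> ('i \<Rightarrow> 'i \<Rightarrow> complex) \<Rightarrow> bool"
  where "psd_kernel I K \<longleftrightarrow> (\<forall>c. (\<Sum>i\<in>I. \<Sum>j\<in>I. cnj (c i) * c j * K i j) \<in> \<real>\<^sub>\<ge>\<^sub>0)"

lemma nonneg_Reals_sum:
  fixes f :: "'i \<Rightarrow> complex"
  shows "(\<And>i. i \<in> I \<Longrightarrow> f i \<in> \<real>\<^sub>\<ge>\<^sub>0) \<Longrightarrow> sum f I \<in> \<real>\<^sub>\<ge>\<^sub>0"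
  by (induction I rule: infinite_finite_induct) (auto intro: nonneg_Reals_add_I)

text \<open>
  The Schur product theorem in the case where one factor is a Gram matrix: writing that factor as a sum
  of terms of rank one, each summand of the quadratic form is again a value of the form of \<open>K\<close>.
\<close>

lemma psd_kernel_mult_functional:
  assumes K: "psd_kernel I K" and pos: "positive_functional \<phi>" and fin: "finite I"
  shows "psd_kernel I (\<lambda>i j. \<phi> (star (s i) * s j) * K i j)"
  unfolding psd_kernel_def
proof
  fix c :: "'a \<Rightarrow> complex"
  obtain m v where
    v: "\<And>i j. i \<in> I \<Longrightarrow> j \<in> I \<Longrightarrow> \<phi> (star (s i) * s j) = (\<Sum>r<(m::nat). cnj (v r i) * v r j)"
    using pos_functional_Gram[OF pos fin, of s] by blast
  have "(\<Sum>i\<in>I. \<Sum>j\<in>I. cnj (c i) * c j * (\<phi> (star (s i) * s j) * K i j))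
      = (\<Sum>i\<in>I. \<Sum>j\<in>I. \<Sum>r<m. cnj (c i * v r i) * (c j * v r j) * K i j)"
    by (intro sum.cong refl) (simp add: v sum_distrib_left sum_distrib_right mult_ac)
  also have "\<dots> = (\<Sum>i\<in>I. \<Sum>r<m. \<Sum>j\<in>I. cnj (c i * v r i) * (c j * v r j) * K i j)"
    by (intro sum.cong refl sum.swap)
  also have "\<dots> = (\<Sum>r<m. \<Sum>i\<in>I. \<Sum>j\<in>I. cnj (c i * v r i) * (c j * v r j) * K i j)"
    by (rule sum.swap)
  also have "\<dots> \<in> \<real>\<^sub>\<ge>\<^sub>0"
    by (rule nonneg_Reals_sum) (rule K[unfolded psd_kernel_def, rule_format])
  finally show "(\<Sum>i\<in>I. \<Sum>j\<in>I. cnj (c i) * c j * (\<phi> (star (s i) * s j) * K i j)) \<in> \<real>\<^sub>\<ge>\<^sub>0" .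
qed

lemma psd_kernel_product_functional:
  assumes "\<And>g. positive_functional (\<phi> g)" "finite F" "finite I"
  shows "psd_kernel I (\<lambda>i j. \<Prod>g\<in>F. \<phi> g (star (s i g) * s j g))"
  using \<open>finite F\<close>
proof induction
  case empty
  have "(\<Sum>i\<in>I. \<Sum>j\<in>I. cnj (c i) * c j) = of_real ((cmod (sum c I))\<^sup>2)" for c
    by (simp add: complex_norm_square sum_product mult_ac del: of_real_power)
      (rule sum.swap)
  then show ?case by (simp add: psd_kernel_def del: of_real_power)
next
  case (insert g F)
  then show ?case
    using psd_kernel_mult_functional[OF insert.IH assms(1)[of g] assms(3), of "\<lambda>i. s i g"] by simp
qed

text \<open>
  The Cauchy-Schwarz inequality between \<open>\<Sum>k. \<Otimes>g. a k g\<close> and the unit for the product of the states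
  \<open>\<phi> g\<close>. It is the positivity of the product kernel on the vector \<open>\<Sum>k. \<Otimes>g. a k g - z \<Otimes>g. 1\<close>,
  where \<open>z\<close> is the value of the product state; the unit is the entry with index \<open>n\<close>.
\<close>

lemma product_functional_Cauchy_Schwarz:
  fixes a :: "nat \<Rightarrow> 'g \<Rightarrow> 'a::cstar_algebra"
  assumes st: "\<And>g. is_state (\<phi> g)" and fin: "finite F"
  shows "(cmod (\<Sum>k<n. \<Prod>g\<in>F. \<phi> g (a k g)))\<^sup>2
    \<le> Re (\<Sum>k<n. \<Sum>l<n. \<Prod>g\<in>F. \<phi> g (star (a k g) * a l g))"
proof -
  define z where "z = (\<Sum>k<n. \<Prod>g\<in>F. \<phi> g (a k g))"
  define Q where "Q = (\<Sum>k<n. \<Sum>l<n. \<Prod>g\<in>F. \<phi> g (star (a k g) * a l g))"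
  define s where "s k g = (if k < n then a k g else 1)" for k g
  define c where "c k = (if k < n then 1 else - z)" for k
  define K where "K = (\<lambda>i j. \<Prod>g\<in>F. \<phi> g (star (s i g) * s j g))"
  have pos: "positive_functional (\<phi> g)" for g using st by (rule state_positive)
  have herm: "\<phi> g (star x) = cnj (\<phi> g x)" for g x
    using pos_functional_hermitian[OF pos, of g x 1] by simp
  have "psd_kernel {..<Suc n} K"
    unfolding K_def by (intro psd_kernel_product_functional pos fin) simp
  then have "(\<Sum>i<Suc n. \<Sum>j<Suc n. cnj (c i) * c j * K i j) \<in> \<real>\<^sub>\<ge>\<^sub>0"
    by (simp only: psd_kernel_def)
  moreover have "(\<Sum>i<Suc n. \<Sum>j<Suc n. cnj (c i) * c j * K i j)
      = Q - z * cnj z - cnj z * z + cnj z * z"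
  proof -
    have Kn: "K n n = 1" by (simp add: K_def s_def state_one[OF st])
    have "(\<Sum>i<n. \<Sum>j<n. cnj (c i) * c j * K i j) = Q"
      unfolding Q_def by (intro sum.cong refl) (simp add: c_def K_def s_def)
    moreover have "(\<Sum>i<n. cnj (c i) * c n * K i n) = - z * cnj z"
      unfolding z_def cnj_sum by (simp add: c_def K_def s_def herm sum_distrib_left flip: z_def)
    moreover have "(\<Sum>j<n. cnj (c n) * c j * K n j) = - cnj z * z"
    proof -
      have "(\<Sum>j<n. cnj (c n) * c j * K n j) = (\<Sum>j<n. - cnj z * (\<Prod>g\<in>F. \<phi> g (a j g)))"
        by (intro sum.cong refl) (simp add: c_def K_def s_def)
      then show ?thesis by (simp only: z_def flip: sum_distrib_left)
    qed
    moreover have "cnj (c n) * c n * K n n = cnj z * z" by (simp add: Kn c_def)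
    ultimately show ?thesis by (simp only: sum.lessThan_Suc sum.distrib) simp
  qed
  ultimately have "Q - z * cnj z - cnj z * z + cnj z * z \<in> \<real>\<^sub>\<ge>\<^sub>0" by (simp only:)
  then have "Re (Q - z * cnj z) \<ge> 0"
    by (simp add: complex_nonneg_Reals_iff)
  moreover have "Re (z * cnj z) = (cmod z)\<^sup>2" by (metis Re_complex_of_real complex_norm_square)
  ultimately show ?thesis by (simp add: Q_def z_def)
qed

section \<open>Extension of bounded operators from dense subspaces\<close>

lemma dense_closed_induct:
  assumes "closure D = UNIV" "closed {x. P x}" "\<And>x. x \<in> D \<Longrightarrow> P x"
  shows "P x"
  using closure_minimal[of D "{x. P x}"] assms by auto

lemma dense_approximation:
  assumes "closure D = UNIV" "e > 0"
  obtains y where "y \<in> D" "dist y x < e"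
proof -
  have "x \<in> closure D" using assms(1) by simp
  then have "\<exists>y\<in>D. dist y x < e" using assms(2) unfolding closure_approachable by blast
  then show ?thesis using that by blast
qed

text \<open>
  The operator is given by its graph \<open>S\<close>, so that one does not have to know beforehand that it is well
  defined: this follows from the bound, applied to differences.
\<close>

lemma bounded_clinear_extension:
  fixes S :: "('x::complex_normed_vector \<times> 'y::{complex_normed_vector, banach}) set"
  assumes add: "\<And>x y x' y'. (x, y) \<in> S \<Longrightarrow> (x', y') \<in> S \<Longrightarrow> (x + x', y + y') \<in> S"
    and scale: "\<And>c x y. (x, y) \<in> S \<Longrightarrow> (c *\<^sub>C x, c *\<^sub>C y) \<in> S"
    and bound: "\<And>x y. (x, y) \<in> S \<Longrightarrow> norm y \<le> K * norm x"
    and dense: "closure (fst ` S) = UNIV" and K: "K \<ge> 0"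
  obtains T where "bounded_clinear T" "\<And>x y. (x, y) \<in> S \<Longrightarrow> T x = y"
    "\<And>x. norm (T x) \<le> K * norm x"
proof -
  have diff: "(x - x', y - y') \<in> S" if "(x, y) \<in> S" "(x', y') \<in> S" for x y x' y'
    using add[OF that(1) scale[OF that(2), of "-1"]] by simp
  have uniq: "y = y'" if "(x, y) \<in> S" "(x, y') \<in> S" for x y y'
    using bound[OF diff[OF that]] by simp
  define f where "f x = (THE y. (x, y) \<in> S)" for x
  have f: "f x = y" if "(x, y) \<in> S" for x y
    unfolding f_def using that uniq by blast
  have fS: "(x, f x) \<in> S" if "x \<in> fst ` S" for x using that f by force
  have "uniformly_continuous_on (fst ` S) f"
    unfolding uniformly_continuous_on_def
  proof (intro allI impI)
    fix e :: real assume "e > 0"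
    have "dist (f x') (f x) < e" if "x \<in> fst ` S" "x' \<in> fst ` S" "dist x' x < e / (K + 1)" for x x'
    proof -
      have "dist (f x') (f x) \<le> K * dist x' x"
        using bound[OF diff[OF fS fS]] that by (auto simp: dist_norm)
      also have "\<dots> \<le> (K + 1) * dist x' x" by (intro mult_right_mono) auto
      also have "\<dots> < e" using that(3) K by (simp add: field_simps)
      finally show ?thesis .
    qed
    then show "\<exists>d>0. \<forall>x\<in>fst ` S. \<forall>x'\<in>fst ` S. dist x' x < d \<longrightarrow> dist (f x') (f x) < e"
      using \<open>e > 0\<close> K by (intro exI[of _ "e / (K + 1)"]) auto
  qed
  then obtain T where "uniformly_continuous_on (closure (fst ` S)) T"
    and ext: "\<And>x. x \<in> fst ` S \<Longrightarrow> f x = T x"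
    by (rule uniformly_continuous_on_extension_on_closure) blast
  then have cont: "continuous_on UNIV T"
    using dense uniformly_continuous_imp_continuous by metis
  have cont_comp: "continuous_on UNIV (\<lambda>x. T (h x))" if "continuous_on UNIV h" for h :: "'x \<Rightarrow> 'x"
    using continuous_on_compose2[OF cont that] by simp
  have T: "T x = y" if "(x, y) \<in> S" for x y
    using that f ext by force
  have TS: "(x, T x) \<in> S" if "x \<in> fst ` S" for x using fS[OF that] ext[OF that] by simp
  have cont_scale: "continuous_on UNIV (\<lambda>x::'z::complex_normed_vector. c *\<^sub>C x)" for c
  proof -
    have "bounded_linear (\<lambda>x::'z. c *\<^sub>C x)"
      by (rule bounded_linear_intro[of _ "cmod c"])
        (auto simp: scaleC_add_right scaleR_scaleC scaleC_scaleC norm_scaleC mult_ac)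
    then show ?thesis by (rule linear_continuous_on)
  qed
  have "T (x + y) = T x + T y" for x y
  proof (rule dense_closed_induct[OF dense, of "\<lambda>x. T (x + y) = T x + T y"])
    show "closed {x. T (x + y) = T x + T y}"
      by (intro closed_Collect_eq continuous_intros cont_comp cont)
    fix x assume x: "x \<in> fst ` S"
    show "T (x + y) = T x + T y"
    proof (rule dense_closed_induct[OF dense, of "\<lambda>y. T (x + y) = T x + T y"])
      show "closed {y. T (x + y) = T x + T y}"
        by (intro closed_Collect_eq continuous_intros cont_comp cont)
      show "T (x + y) = T x + T y" if "y \<in> fst ` S" for y
        by (rule T[OF add[OF TS[OF x] TS[OF that]]])
    qed
  qed
  moreover have "T (c *\<^sub>C x) = c *\<^sub>C T x" for c x
  proof (rule dense_closed_induct[OF dense, of "\<lambda>x. T (c *\<^sub>C x) = c *\<^sub>C T x"])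
    show "closed {x. T (c *\<^sub>C x) = c *\<^sub>C T x}"
      using continuous_on_compose2[OF cont_scale cont]
      by (intro closed_Collect_eq cont_comp cont_scale) auto
    show "T (c *\<^sub>C x) = c *\<^sub>C T x" if "x \<in> fst ` S" for x
      by (rule T[OF scale[OF TS[OF that]]])
  qed
  moreover have Tb: "norm (T x) \<le> K * norm x" for x
  proof (rule dense_closed_induct[OF dense, of "\<lambda>x. norm (T x) \<le> K * norm x"])
    show "closed {x. norm (T x) \<le> K * norm x}"
      by (intro closed_Collect_le continuous_intros cont)
    show "norm (T x) \<le> K * norm x" if "x \<in> fst ` S" for x by (rule bound[OF TS[OF that]])
  qed
  ultimately have "bounded_clinear T" by (intro bounded_clinearI[of T K]) (auto simp: mult.commute)
  then show ?thesis using T Tb by (rule that)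
qed

section \<open>The product trace on an infinite tensor power\<close>

definition elementary_tensor ::
    "('g \<Rightarrow> 'a::cstar_algebra \<Rightarrow> 'b::cstar_algebra) \<Rightarrow> 'g list \<Rightarrow> ('g \<Rightarrow> 'a) \<Rightarrow> 'b"
  where "elementary_tensor \<iota> gs f = prod_list (map (\<lambda>g. \<iota> g (f g)) gs)"

lemma tensor_sum_elementary: "tensor_sum \<iota> gs n a = (\<Sum>k<n. elementary_tensor \<iota> gs (a k))"
  by (simp add: tensor_sum_def elementary_tensor_def)

text \<open>
  The algebraic part of an infinite tensor power: elementary tensors can be multiplied and adjoined
  factor by factor, and reordered, because different factors commute.
\<close>

locale commuting_factors =
  fixes \<iota> :: "'g \<Rightarrow> 'a::cstar_algebra \<Rightarrow> 'b::cstar_algebra"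
  assumes hom: "unital_star_hom (\<iota> g)"
    and commute: "g \<noteq> h \<Longrightarrow> \<iota> g a * \<iota> h b = \<iota> h b * \<iota> g a"
begin

abbreviation "E \<equiv> elementary_tensor \<iota>"

lemmas hom_simps = unital_star_homD[OF hom]

lemma E_simps [simp]:
  "E [] f = 1" "E (g # gs) f = \<iota> g (f g) * E gs f" "E (gs @ hs) f = E gs f * E hs f"
  by (auto simp: elementary_tensor_def)

lemma E_cong: "(\<And>g. g \<in> set gs \<Longrightarrow> f g = f' g) \<Longrightarrow> E gs f = E gs f'"
  unfolding elementary_tensor_def by (metis (mono_tags, lifting) map_eq_conv)

lemma E_commute: "h \<notin> set gs \<Longrightarrow> E gs f * \<iota> h b = \<iota> h b * E gs f"
proof (induction gs)
  case (Cons g gs)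
  then have "E (g # gs) f * \<iota> h b = (\<iota> g (f g) * \<iota> h b) * E gs f" by (simp add: mult.assoc)
  also have "\<iota> g (f g) * \<iota> h b = \<iota> h b * \<iota> g (f g)" using Cons by (intro commute) auto
  finally show ?case by (simp add: mult.assoc)
qed simp

lemma E_mult: "distinct gs \<Longrightarrow> E gs f * E gs f' = E gs (\<lambda>g. f g * f' g)"
proof (induction gs)
  case (Cons g gs)
  have "E (g # gs) f * E (g # gs) f' = \<iota> g (f g) * (E gs f * \<iota> g (f' g)) * E gs f'"
    by (simp add: mult.assoc)
  also have "E gs f * \<iota> g (f' g) = \<iota> g (f' g) * E gs f" using Cons by (intro E_commute) auto
  also have "\<iota> g (f g) * (\<iota> g (f' g) * E gs f) * E gs f' = \<iota> g (f g * f' g) * (E gs f * E gs f')"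
    by (simp add: mult.assoc hom_simps)
  finally show ?case using Cons by simp
qed simp

lemma E_star: "distinct gs \<Longrightarrow> star (E gs f) = E gs (\<lambda>g. star (f g))"
proof (induction gs)
  case (Cons g gs)
  then have "star (E (g # gs) f) = E gs (\<lambda>g. star (f g)) * \<iota> g (star (f g))"
    by (simp add: star_mult hom_simps)
  also have "\<dots> = \<iota> g (star (f g)) * E gs (\<lambda>g. star (f g))" using Cons by (intro E_commute) auto
  finally show ?case by simp
qed simp

lemma E_permute: "distinct gs \<Longrightarrow> distinct hs \<Longrightarrow> set gs = set hs \<Longrightarrow> E gs f = E hs f"
proof (induction gs arbitrary: hs)
  case (Cons g gs)
  obtain us vs where hs: "hs = us @ g # vs" using Cons.prems(3) by (metis list.set_intros(1) split_list)
  have "set gs = set (us @ vs)" using Cons.prems unfolding hs by auto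
  then have IH: "E gs f = E us f * E vs f"
    using Cons.IH[of "us @ vs"] Cons.prems(1,2) \<open>set gs = set (us @ vs)\<close> by (simp add: hs)
  have "E hs f = (E us f * \<iota> g (f g)) * E vs f" by (simp add: hs mult.assoc)
  also have "E us f * \<iota> g (f g) = \<iota> g (f g) * E us f" using Cons.prems hs by (intro E_commute) auto
  finally show ?case by (simp add: IH mult.assoc)
qed simp

lemma E_one: "(\<And>g. g \<in> set gs \<Longrightarrow> f g = 1) \<Longrightarrow> E gs f = 1"
  by (induction gs) (auto simp: hom_simps)

text \<open>
  Enlarging the support by units lets any two finite sums of elementary tensors be written over
  the same list of positions.
\<close>

lemma E_extend:
  assumes "distinct gs" "distinct hs" "set gs \<subseteq> set hs"
  shows "E gs f = E hs (\<lambda>g. if g \<in> set gs then f g else 1)"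
proof -
  let ?f = "\<lambda>g. if g \<in> set gs then f g else 1"
  let ?r = "filter (\<lambda>g. g \<notin> set gs) hs"
  have "E hs ?f = E (gs @ ?r) ?f" using assms by (intro E_permute) auto
  also have "\<dots> = E gs f" using E_one[of ?r ?f] E_cong[of gs ?f f] by simp
  finally show ?thesis by simp
qed

text \<open>
  A scalar is absorbed into a single factor, so there has to be a factor: the support must contain
  some position \<open>g\<close>.
\<close>

lemma E_scale: "distinct gs \<Longrightarrow> g \<in> set gs \<Longrightarrow> E gs (f(g := c *\<^sub>C f g)) = c *\<^sub>C E gs f"
proof (induction gs)
  case (Cons h gs)
  show ?case
  proof (cases "g = h")
    case True
    then have "E gs (f(g := c *\<^sub>C f g)) = E gs f" using Cons.prems by (intro E_cong) auto
    then show ?thesis using True by (simp only: E_simps fun_upd_same hom_simps(2) scaleC_mult_left)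
  next
    case False
    then show ?thesis using Cons by (simp add: scaleC_mult_right)
  qed
qed simp

end

lemma sum_lessThan_add:
  fixes f :: "nat \<Rightarrow> 'z::comm_monoid_add"
  shows "(\<Sum>k<n + m. f k) = (\<Sum>k<n. f k) + (\<Sum>k<m. f (n + k))"
  by (induction m) (auto simp: add.assoc)

text \<open>
  On finite sums of elementary tensors the trace has to be \<open>\<Sum>k. \<Prod>g. \<tau> (a k g)\<close>. The minimal norm
  dominates the norm of the action on the unit vector in the tensor product of the GNS spaces of \<open>\<tau>\<close>,
  so by the Cauchy-Schwarz inequality for product states this formula is contractive, in particular
  well defined, and extends to the whole algebra. Positivity of the extension is the Schur product
  theorem.
\<close>

lemma (in commuting_factors) product_trace_exists:
  fixes \<tau> :: "'a \<Rightarrow> complex"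
  assumes tr: "is_trace \<tau>"
    and norm: "\<And>gs n a. distinct gs \<Longrightarrow> ereal (norm (tensor_sum \<iota> gs n a)) = min_tensor_norm (set gs) n a"
    and dense: "closure {tensor_sum \<iota> gs n a | gs n a. distinct gs} = UNIV"
  shows "\<exists>T :: 'b \<Rightarrow> complex. is_trace T"
proof -
  have st: "is_state \<tau>" and comm: "\<And>x y. \<tau> (x * y) = \<tau> (y * x)"
    using tr by (auto simp: is_trace_def)
  note pos = state_positive[OF st]
  note lin = pos_functional_linear[OF pos]
  define \<Phi> where "\<Phi> gs n a = (\<Sum>k<n. \<Prod>g\<in>set gs. \<tau> (a k g))" for gs :: "'g list" and n :: nat
    and a :: "nat \<Rightarrow> 'g \<Rightarrow> 'a"
  define S where "S = {(tensor_sum \<iota> gs n a, \<Phi> gs n a) | gs n a. distinct gs}"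
  have bound: "cmod z \<le> 1 * norm x" if "(x, z) \<in> S" for x z
  proof -
    from that obtain gs n a where d: "distinct gs" and x: "x = tensor_sum \<iota> gs n a" and z: "z = \<Phi> gs n a"
      by (auto simp: S_def)
    \<comment> \<open>The unit vector: in the supremum defining the minimal norm take \<open>p = 1\<close>, the family \<open>1\<close> and all states equal to \<open>\<tau>\<close>.\<close>
    let ?s = "\<lambda>(_::nat) (_::'g). 1 :: 'a"
    let ?N = "gns_tensor_norm (\<lambda>_. \<tau>) (set gs) ({..<n} \<times> {..<1::nat}) (\<lambda>(k, j) g. a k g * ?s j g)"
    have index: "{..<n} \<times> {..<1::nat} = (\<lambda>k. (k, 0)) ` {..<n}" by auto
    have "?N = sqrt (Re (\<Sum>k<n. \<Sum>l<n. \<Prod>g\<in>set gs. \<tau> (star (a k g) * a l g)))"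
      unfolding gns_tensor_norm_def index by (simp add: sum.reindex inj_on_def)
    moreover have "(cmod z)\<^sup>2 \<le> Re (\<Sum>k<n. \<Sum>l<n. \<Prod>g\<in>set gs. \<tau> (star (a k g) * a l g))"
      unfolding z \<Phi>_def by (rule product_functional_Cauchy_Schwarz) (use st in auto)
    ultimately have "cmod z \<le> ?N" by (simp add: real_le_rsqrt)
    moreover have "ereal ?N \<le> min_tensor_norm (set gs) n a"
      unfolding min_tensor_norm_def
    proof (rule Sup_upper, rule CollectI, intro exI conjI)
      show "\<forall>g. is_state ((\<lambda>_. \<tau>) g)" using st by simp
      show "gns_tensor_norm (\<lambda>_. \<tau>) (set gs) {..<1::nat} ?s \<le> 1"
        by (simp add: gns_tensor_norm_def state_one[OF st])
    qed simp
    ultimately have "ereal (cmod z) \<le> ereal (norm x)"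
      unfolding x norm[OF d] by (meson ereal_less_eq(3) order_trans)
    then show ?thesis by simp
  qed
  have extend: "\<exists>a'. tensor_sum \<iota> gs n a = tensor_sum \<iota> hs n a' \<and> \<Phi> gs n a = \<Phi> hs n a'"
    if "distinct gs" "distinct hs" "set gs \<subseteq> set hs" for gs hs n a
  proof (intro exI conjI)
    let ?a = "\<lambda>k g. if g \<in> set gs then a k g else 1"
    show "tensor_sum \<iota> gs n a = tensor_sum \<iota> hs n ?a"
      unfolding tensor_sum_elementary by (intro sum.cong refl E_extend that)
    have "(\<Prod>g\<in>set gs. \<tau> (a k g)) = (\<Prod>g\<in>set hs. \<tau> (?a k g))" for k
      using that(3) by (intro prod.mono_neutral_cong_left) (auto simp: state_one[OF st])
    then show "\<Phi> gs n a = \<Phi> hs n ?a" by (simp add: \<Phi>_def)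
  qed
  have add: "(x + x', z + z') \<in> S" if "(x, z) \<in> S" "(x', z') \<in> S" for x z x' z'
  proof -
    from that(1) obtain gs n a where d: "distinct gs" and x: "x = tensor_sum \<iota> gs n a" and z: "z = \<Phi> gs n a"
      by (auto simp: S_def)
    from that(2) obtain gs' n' a' where d': "distinct gs'" and x': "x' = tensor_sum \<iota> gs' n' a'" and z': "z' = \<Phi> gs' n' a'"
      by (auto simp: S_def)
    define hs where "hs = remdups (gs @ gs')"
    have hs: "distinct hs" "set gs \<subseteq> set hs" "set gs' \<subseteq> set hs" by (auto simp: hs_def)
    obtain b where b: "x = tensor_sum \<iota> hs n b" "z = \<Phi> hs n b"
      using extend[OF d hs(1,2)] x z by metis
    obtain b' where b': "x' = tensor_sum \<iota> hs n' b'" "z' = \<Phi> hs n' b'"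
      using extend[OF d' hs(1,3)] x' z' by metis
    define c where "c k = (if k < n then b k else b' (k - n))" for k
    have "x + x' = tensor_sum \<iota> hs (n + n') c" "z + z' = \<Phi> hs (n + n') c"
      by (simp_all add: b b' tensor_sum_elementary \<Phi>_def c_def sum_lessThan_add)
    then show ?thesis using hs(1) by (auto simp: S_def)
  qed
  have scale: "(c *\<^sub>C x, c *\<^sub>C z) \<in> S" if "(x, z) \<in> S" for c x z
  proof -
    from that obtain gs n a where d: "distinct gs" and x: "x = tensor_sum \<iota> gs n a" and z: "z = \<Phi> gs n a"
      by (auto simp: S_def)
    \<comment> \<open>The list \<open>gs\<close> may be empty, so a position that can absorb the scalar is added.\<close>
    fix g\<^sub>0 :: 'g
    define hs where "hs = remdups (g\<^sub>0 # gs)"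
    have hs: "distinct hs" "set gs \<subseteq> set hs" "g\<^sub>0 \<in> set hs" by (auto simp: hs_def)
    obtain b where b: "x = tensor_sum \<iota> hs n b" "z = \<Phi> hs n b"
      using extend[OF d hs(1,2)] x z by metis
    let ?b = "\<lambda>k. (b k)(g\<^sub>0 := c *\<^sub>C b k g\<^sub>0)"
    have prod: "(\<Prod>g\<in>set hs. \<tau> (?b k g)) = c * (\<Prod>g\<in>set hs. \<tau> (b k g))" for k
    proof -
      have "(\<Prod>g\<in>set hs - {g\<^sub>0}. \<tau> (?b k g)) = (\<Prod>g\<in>set hs - {g\<^sub>0}. \<tau> (b k g))"
        by (intro prod.cong) auto
      then show ?thesis
        using hs(3) by (simp add: prod.remove[of "set hs" g\<^sub>0] lin mult.assoc)
    qed
    have "c *\<^sub>C x = tensor_sum \<iota> hs n ?b"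
      by (simp add: b tensor_sum_elementary scaleC_sum_right E_scale[OF hs(1,3)])
    moreover have "c *\<^sub>C z = \<Phi> hs n ?b"
      by (simp add: b \<Phi>_def prod scaleC_complex_def sum_distrib_left del: fun_upd_apply)
    ultimately show ?thesis using hs(1) unfolding S_def by blast
  qed
  define D where "D = {tensor_sum \<iota> gs n a | gs n a. distinct gs}"
  have D: "fst ` S = D" by (force simp: S_def D_def)
  obtain T :: "'b \<Rightarrow> complex" where T: "bounded_clinear T" "\<And>x z. (x, z) \<in> S \<Longrightarrow> T x = z"
    by (rule bounded_clinear_extension[of S 1])
      (use add scale bound dense in \<open>auto simp: D D_def\<close>)
  note T_lin = bounded_clinearD[OF T(1)]
  have T_E: "T (E gs f) = (\<Prod>g\<in>set gs. \<tau> (f g))" if "distinct gs" for gs f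
  proof (rule T(2))
    have "(tensor_sum \<iota> gs 1 (\<lambda>_. f), \<Phi> gs 1 (\<lambda>_. f)) \<in> S" using that by (auto simp: S_def)
    then show "(E gs f, \<Prod>g\<in>set gs. \<tau> (f g)) \<in> S" by (simp add: tensor_sum_elementary \<Phi>_def)
  qed
  have common: "\<exists>hs b b'. distinct hs \<and> x = tensor_sum \<iota> hs n b \<and> x' = tensor_sum \<iota> hs n' b'"
    if "x = tensor_sum \<iota> gs n a" "x' = tensor_sum \<iota> gs' n' a'" "distinct gs" "distinct gs'"
    for x x' gs gs' n n' a a'
  proof -
    have "\<exists>b. x = tensor_sum \<iota> (remdups (gs @ gs')) n b"
      using extend[of gs "remdups (gs @ gs')" n a] that by auto
    moreover have "\<exists>b. x' = tensor_sum \<iota> (remdups (gs @ gs')) n' b"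
      using extend[of gs' "remdups (gs @ gs')" n' a'] that by auto
    ultimately show ?thesis using distinct_remdups by blast
  qed
  have D_tr: "T (x * y) = T (y * x)" if "x \<in> D" "y \<in> D" for x y
  proof -
    from that obtain hs n n' b b' where "distinct hs" "x = tensor_sum \<iota> hs n b" "y = tensor_sum \<iota> hs n' b'"
      using common unfolding D_def by blast
    then show ?thesis
      unfolding tensor_sum_elementary
      by (simp add: sum_product T_lin E_mult T_E comm del: E_simps) (rule sum.swap)
  qed
  have D_pos: "T (star x * x) \<in> \<real>\<^sub>\<ge>\<^sub>0" if "x \<in> D" for x
  proof -
    from that obtain gs n a where d: "distinct gs" and x: "x = tensor_sum \<iota> gs n a"
      by (auto simp: D_def)
    have "T (star x * x) = (\<Sum>k<n. \<Sum>l<n. \<Prod>g\<in>set gs. \<tau> (star (a k g) * a l g))"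
      unfolding x tensor_sum_elementary
      by (simp add: star_sum sum_product T_lin E_mult E_star T_E d del: E_simps)
    also have "\<dots> \<in> \<real>\<^sub>\<ge>\<^sub>0"
      using psd_kernel_product_functional[of "\<lambda>_. \<tau>" "set gs" "{..<n}" a] pos
      unfolding psd_kernel_def by (auto dest: spec[of _ "\<lambda>_. 1"])
    finally show ?thesis .
  qed
  have dense': "closure D = UNIV" using dense by (simp add: D_def)
  have cont: "continuous_on UNIV (\<lambda>x. T (h x))" if "continuous_on UNIV h" for h :: "'b \<Rightarrow> 'b"
    using continuous_on_compose2[OF T_lin(7)[of UNIV] that] by simp
  have "T (x * y) = T (y * x)" for x y
  proof (rule dense_closed_induct[OF dense', of "\<lambda>x. T (x * y) = T (y * x)"])
    show "closed {x. T (x * y) = T (y * x)}"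
      by (intro closed_Collect_eq cont continuous_intros)
    fix x assume "x \<in> D"
    show "T (x * y) = T (y * x)"
      by (rule dense_closed_induct[OF dense', of "\<lambda>y. T (x * y) = T (y * x)"])
        (intro closed_Collect_eq cont continuous_intros D_tr \<open>x \<in> D\<close>)+
  qed
  moreover have "T (star x * x) \<in> \<real>\<^sub>\<ge>\<^sub>0" for x
  proof (rule dense_closed_induct[OF dense', of "\<lambda>x. T (star x * x) \<in> \<real>\<^sub>\<ge>\<^sub>0"])
    have "continuous_on UNIV (\<lambda>x. T (star x * x))" by (intro cont continuous_intros)
    then show "closed {x. T (star x * x) \<in> \<real>\<^sub>\<ge>\<^sub>0}"
      using continuous_closed_vimage[of "\<real>\<^sub>\<ge>\<^sub>0" "\<lambda>x. T (star x * x)"] closed_nonneg_Reals_complex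
      by (simp add: vimage_def continuous_on_eq_continuous_at)
  qed (rule D_pos)
  moreover have "T 1 = 1" using T_E[of "[]"] by simp
  ultimately show ?thesis
    using T(1) is_stateI[of T] unfolding is_trace_def positive_functional_def by blast
qed

section \<open>The GNS representation of an invariant trace\<close>

text \<open>
  The norm determines the inner product, so isometries preserve it.
\<close>

lemma cinner_polarization:
  fixes x y :: "'h::complex_hilbert_space"
  shows "4 * cinner x y = of_real ((norm (x + y))\<^sup>2) - of_real ((norm (x - y))\<^sup>2)
    + \<i> * of_real ((norm (x + \<i> *\<^sub>C y))\<^sup>2) - \<i> * of_real ((norm (x - \<i> *\<^sub>C y))\<^sup>2)"
proof -
  have add_right: "cinner x (y + z) = cinner x y + cinner x z" for x y z :: 'h
    by (subst (1 2 3) cinner_commute) (simp add: cinner_add_left)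
  have scale_right: "cinner x (c *\<^sub>C y) = cnj c * cinner x y" for x y :: 'h and c
    by (subst (1 2) cinner_commute) (simp add: cinner_scaleC_left)
  have minus: "- x = (- 1) *\<^sub>C x" for x :: 'h by simp
  show ?thesis
    unfolding cinner_self[symmetric] diff_conv_add_uminus[of x]
    by (simp add: minus cinner_add_left cinner_scaleC_left add_right scale_right
        scaleC_scaleC algebra_simps del: scaleC_minus_left)
qed

lemma isometry_preserves_cinner:
  assumes "bounded_clinear U" "\<And>x. norm (U x) = norm x"
  shows "cinner (U x) (U y) = cinner x y"
proof -
  have "4 * cinner (U x) (U y) = 4 * cinner x y"
    unfolding cinner_polarization
    by (simp only: assms(2) flip: bounded_clinearD[OF assms(1)])
  then show ?thesis by simp
qed

locale gns =
  fixes \<tau> :: "'c::cstar_algebra \<Rightarrow> complex" and \<pi> :: "'c \<Rightarrow> 'h::complex_hilbert_space \<Rightarrow> 'h" and \<xi> :: 'h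
  assumes state: "is_state \<tau>" and gns: "gns_representation \<tau> \<pi> \<xi>"
begin

lemma rep:
  "bounded_clinear (\<pi> a)" "\<pi> (a + b) v = \<pi> a v + \<pi> b v" "\<pi> (c *\<^sub>C a) v = c *\<^sub>C \<pi> a v"
  "\<pi> (a * b) v = \<pi> a (\<pi> b v)" "\<pi> 1 v = v"
  "cinner (\<pi> a v) w = cinner v (\<pi> (star a) w)"
  using gns by (auto simp: gns_representation_def star_representation_def adjoint_pair_def)

lemma rep_diff: "\<pi> (a - b) v = \<pi> a v - \<pi> b v"
  using rep(2)[of "a - b" b v] by (simp add: algebra_simps)

lemma cyclic: "closure (range (\<lambda>a. \<pi> a \<xi>)) = UNIV"
  using gns by (simp add: gns_representation_def)

lemma norm_vector: "(norm (\<pi> a \<xi>))\<^sup>2 = Re (\<tau> (star a * a))"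
proof -
  have "\<tau> (star a * a) = cinner (\<pi> (star a) (\<pi> a \<xi>)) \<xi>"
    using gns by (simp add: gns_representation_def flip: rep(4))
  also have "\<dots> = of_real ((norm (\<pi> a \<xi>))\<^sup>2)" by (simp only: rep(6) star_star cinner_self)
  finally show ?thesis by simp
qed

text \<open>
  On the GNS space every linear map of the algebra that is bounded for the seminorm of \<open>\<tau>\<close> induces a
  bounded operator. The instances used below are left and right multiplications and
  trace-preserving endomorphisms.
\<close>

lemma operator_exists:
  assumes add: "\<And>a b. \<theta> (a + b) = \<theta> a + \<theta> b" and scale: "\<And>c a. \<theta> (c *\<^sub>C a) = c *\<^sub>C \<theta> a"
    and bound: "\<And>a. Re (\<tau> (star (\<theta> a) * \<theta> a)) \<le> K\<^sup>2 * Re (\<tau> (star a * a))" and K: "K \<ge> 0"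
  obtains T where "bounded_clinear T" "\<And>a. T (\<pi> a \<xi>) = \<pi> (\<theta> a) \<xi>" "\<And>v. norm (T v) \<le> K * norm v"
proof -
  define S where "S = range (\<lambda>a. (\<pi> a \<xi>, \<pi> (\<theta> a) \<xi>))"
  have S_fst: "fst ` S = range (\<lambda>a. \<pi> a \<xi>)" by (force simp: S_def)
  obtain T where "bounded_clinear T" and T: "\<And>x y. (x, y) \<in> S \<Longrightarrow> T x = y"
    and "\<And>v. norm (T v) \<le> K * norm v"
  proof (rule bounded_clinear_extension[of S K])
    show "(x + x', y + y') \<in> S" if "(x, y) \<in> S" "(x', y') \<in> S" for x y x' y'
      using that unfolding S_def by (auto simp flip: rep add)
    show "(c *\<^sub>C x, c *\<^sub>C y) \<in> S" if "(x, y) \<in> S" for c x y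
      using that unfolding S_def by (auto simp flip: rep scale)
    show "norm y \<le> K * norm x" if xy: "(x, y) \<in> S" for x y
    proof (rule power2_le_imp_le)
      show "(norm y)\<^sup>2 \<le> (K * norm x)\<^sup>2"
        using xy bound by (auto simp: S_def power_mult_distrib norm_vector)
    qed (use K in simp)
    show "closure (fst ` S) = UNIV" by (simp add: S_fst cyclic)
  qed (use K in auto)
  then show ?thesis by (intro that[of T]) (auto simp: S_def)
qed

lemma operator_eqI:
  assumes "bounded_clinear T" "bounded_clinear T'" "\<And>a. T (\<pi> a \<xi>) = T' (\<pi> a \<xi>)"
  shows "T = T'"
proof
  fix v
  show "T v = T' v"
    by (rule dense_closed_induct[OF cyclic, of "\<lambda>v. T v = T' v"])
      (use assms in \<open>auto intro!: closed_Collect_eq bounded_clinearD(7)\<close>)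
qed

lemma contractive: "norm (\<pi> b v) \<le> norm b * norm v"
proof -
  obtain T where T: "bounded_clinear T" "\<And>a. T (\<pi> a \<xi>) = \<pi> (b * a) \<xi>"
    "\<And>v. norm (T v) \<le> norm b * norm v"
    by (rule operator_exists[of "\<lambda>a. b * a" "norm b"])
      (auto simp: distrib_left scaleC_mult_right pos_functional_mult_bound state_positive[OF state])
  \<comment> \<open>Both operators send \<open>\<pi> a \<xi>\<close> to \<open>\<pi> (b * a) \<xi>\<close>; the bound is only known for \<open>T\<close>.\<close>
  have "T = \<pi> b" by (rule operator_eqI) (simp_all add: T rep)
  then show ?thesis using T(3) by simp
qed

lemma norm_cyclic: "norm \<xi> = 1"
proof (rule power2_eq_imp_eq)
  show "(norm \<xi>)\<^sup>2 = 1\<^sup>2" using norm_vector[of 1] state_one[OF state] by (simp add: rep)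
qed simp_all

text \<open>
  For a trace, \<open>\<tau> (star (a * x) * (a * x)) = \<tau> (star (star x * star a) * (star x * star a))\<close>, so that
  right multiplication is as bounded as left multiplication. Right multiplications commute with the
  representation, hence with everything in the generated von Neumann algebra.
\<close>

lemma right_multiplication:
  assumes "\<And>x y. \<tau> (x * y) = \<tau> (y * x)"
  obtains R where "R \<in> commutant (range \<pi>)" "\<And>a. R (\<pi> a \<xi>) = \<pi> (a * x) \<xi>"
    "\<And>v. norm (R v) \<le> norm x * norm v"
proof -
  have "Re (\<tau> (star (a * x) * (a * x))) \<le> (norm x)\<^sup>2 * Re (\<tau> (star a * a))" for a
  proof -
    have "\<tau> (star (a * x) * (a * x)) = \<tau> (star (star x * star a) * (star x * star a))"
      by (subst assms) (simp add: star_mult)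
    also have "Re \<dots> \<le> (norm (star x))\<^sup>2 * Re (\<tau> (star (star a) * star a))"
      by (intro pos_functional_mult_bound state_positive state)
    finally show ?thesis using assms[of a "star a"] by simp
  qed
  then obtain R where R: "bounded_clinear R" "\<And>a. R (\<pi> a \<xi>) = \<pi> (a * x) \<xi>"
    "\<And>v. norm (R v) \<le> norm x * norm v"
    using operator_exists[of "\<lambda>a. a * x" "norm x"]
    by (auto simp: distrib_right scaleC_mult_left)
  have "R \<circ> \<pi> b = \<pi> b \<circ> R" for b
    by (rule operator_eqI)
      (auto intro!: bounded_clinear_compose R rep simp: R mult.assoc simp flip: rep(4))
  then have "R \<in> commutant (range \<pi>)" using R by (auto simp: commutant_def)
  then show ?thesis using that R by blast
qed

text \<open>
  Invariance makes \<open>\<pi> a \<xi> \<mapsto> \<pi> (\<theta> a) \<xi>\<close> a unitary \<open>U\<close> with inverse \<open>V\<close>, and conjugation with \<open>U\<close> extends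
  \<open>\<theta>\<close>. It maps the bicommutant into itself: for \<open>T\<close> in the commutant of the representation, \<open>V \<circ> T \<circ> U\<close>
  also lies there.
\<close>

lemma invariant_extension_exists:
  assumes \<theta>: "unital_star_hom \<theta>" and \<theta>': "unital_star_hom \<theta>'"
    and inv: "\<And>a. \<theta> (\<theta>' a) = a" "\<And>a. \<theta>' (\<theta> a) = a"
    and invariant: "\<And>a. \<tau> (\<theta> a) = \<tau> a"
  shows "\<exists>\<beta>. vn_extension \<pi> \<theta> \<beta>"
proof -
  note \<theta>_simps = unital_star_homD[OF \<theta>] and \<theta>'_simps = unital_star_homD[OF \<theta>']
  have invariant': "\<tau> (\<theta>' a) = \<tau> a" for a using invariant[of "\<theta>' a"] inv by simp
  obtain U where U: "bounded_clinear U" "\<And>a. U (\<pi> a \<xi>) = \<pi> (\<theta> a) \<xi>" "\<And>v. norm (U v) \<le> 1 * norm v"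
    by (rule operator_exists[of \<theta> 1])
      (auto simp: \<theta>_simps(1,2) invariant simp flip: \<theta>_simps(3,4))
  obtain V where V: "bounded_clinear V" "\<And>a. V (\<pi> a \<xi>) = \<pi> (\<theta>' a) \<xi>" "\<And>v. norm (V v) \<le> 1 * norm v"
    by (rule operator_exists[of \<theta>' 1])
      (auto simp: \<theta>'_simps(1,2) invariant' simp flip: \<theta>'_simps(3,4))
  have id: "bounded_clinear (\<lambda>v. v)" by (auto simp: bounded_clinear_def bounded_linear_ident)
  have "U \<circ> V = (\<lambda>v. v)"
    by (rule operator_eqI) (auto intro!: bounded_clinear_compose U V id simp: U V inv)
  then have UV: "U (V v) = v" for v by (metis comp_apply)
  have "V \<circ> U = (\<lambda>v. v)"
    by (rule operator_eqI) (auto intro!: bounded_clinear_compose U V id simp: U V inv)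
  then have VU: "V (U v) = v" for v by (metis comp_apply)
  have "norm (U v) = norm v" for v using U(3)[of v] V(3)[of "U v"] by (simp add: VU)
  then have U_iso: "cinner (U v) (U w) = cinner v w" for v w
    by (intro isometry_preserves_cinner U)
  have U_adj: "cinner (U v) w = cinner v (V w)" for v w
    using U_iso[of v "V w"] by (simp add: UV)
  have V_adj: "cinner (V v) w = cinner v (U w)" for v w
    using U_iso[of "V v" w] by (simp add: UV)
  have U_rep: "U (\<pi> a v) = \<pi> (\<theta> a) (U v)" for a v
  proof -
    have "U \<circ> \<pi> a = \<pi> (\<theta> a) \<circ> U"
      by (rule operator_eqI)
        (auto intro!: bounded_clinear_compose U rep simp: U \<theta>_simps simp flip: rep(4))
    then show ?thesis by (metis comp_apply)
  qed
  have V_rep: "V (\<pi> a v) = \<pi> (\<theta>' a) (V v)" for a v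
    using U_rep[of "\<theta>' a" "V v"] by (metis inv(1) UV VU)
  define M where "M = generated_vn_algebra \<pi>"
  have M_iff: "x \<in> M \<longleftrightarrow> bounded_clinear x \<and>
    (\<forall>T. bounded_clinear T \<longrightarrow> (\<forall>a v. T (\<pi> a v) = \<pi> a (T v)) \<longrightarrow> (\<forall>v. x (T v) = T (x v)))" for x
    unfolding M_def generated_vn_algebra_def commutant_def by (auto simp: fun_eq_iff)
  have conj_M: "P \<circ> x \<circ> Q \<in> M"
    if x: "x \<in> M" and PQ: "bounded_clinear P" "bounded_clinear Q" "\<And>v. P (Q v) = v" "\<And>v. Q (P v) = v"
      and P_rep: "\<And>a v. P (\<pi> a v) = \<pi> (\<eta> a) (P v)"
      and Q_rep: "\<And>a v. Q (\<pi> a v) = \<pi> (\<eta>' a) (Q v)"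
      and \<eta>: "\<And>a. \<eta>' (\<eta> a) = a" for P Q x \<eta> \<eta>'
    unfolding M_iff
  proof (intro conjI allI impI)
    show "bounded_clinear (P \<circ> x \<circ> Q)"
      using x PQ(1,2) by (intro bounded_clinear_compose) (auto simp: M_iff)
    fix T v assume T: "bounded_clinear T" "\<forall>a v. T (\<pi> a v) = \<pi> a (T v)"
    have "bounded_clinear (Q \<circ> T \<circ> P)" by (intro bounded_clinear_compose T PQ)
    moreover have "(Q \<circ> T \<circ> P) (\<pi> a v) = \<pi> a ((Q \<circ> T \<circ> P) v)" for a v
      by (simp add: P_rep Q_rep T \<eta>)
    ultimately have "x ((Q \<circ> T \<circ> P) (Q v)) = (Q \<circ> T \<circ> P) (x (Q v))"
      using x by (auto simp: M_iff)
    then show "(P \<circ> x \<circ> Q) (T v) = T ((P \<circ> x \<circ> Q) v)" by (simp add: PQ)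
  qed
  define \<beta> where "\<beta> x = U \<circ> x \<circ> V" for x
  have \<beta>_M: "\<beta> x \<in> M" if "x \<in> M" for x
    unfolding \<beta>_def by (rule conj_M[OF that U(1) V(1) UV VU U_rep V_rep inv(2)])
  have \<beta>'_M: "V \<circ> x \<circ> U \<in> M" if "x \<in> M" for x
    by (rule conj_M[OF that V(1) U(1) VU UV V_rep U_rep inv(1)])
  have "bij_betw \<beta> M M"
    by (rule bij_betw_byWitness[of _ "\<lambda>x. V \<circ> x \<circ> U"])
      (auto simp: \<beta>_M \<beta>'_M, auto simp: \<beta>_def UV VU fun_eq_iff)
  then have "vn_automorphism M \<beta>"
    unfolding vn_automorphism_def
    by (auto simp: \<beta>_def fun_eq_iff bounded_clinearD[OF U(1)] VU adjoint_pair_def U_adj V_adj)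
  moreover have "\<beta> (\<pi> a) = \<pi> (\<theta> a)" for a
    by (simp add: \<beta>_def fun_eq_iff U_rep UV)
  ultimately show ?thesis by (auto simp: vn_extension_def M_def)
qed

end

section \<open>Independence of the tensor factors\<close>

text \<open>
  For one tensor factor, the vectors in the definition of the minimal norm are vectors of the GNS
  space of a single state, where \<open>a\<close> acts with norm at most \<open>\<parallel>a\<parallel>\<close>.
\<close>

lemma factor_norm_le:
  assumes "infinite_min_tensor_power \<iota>"
  shows "norm (\<iota> h a) \<le> norm a"
proof -
  have "min_tensor_norm {h} 1 (\<lambda>_ _. a) \<le> ereal (norm a)"
    unfolding min_tensor_norm_def
  proof (rule Sup_least, clarify)
    fix \<phi> :: "'a \<Rightarrow> 'b \<Rightarrow> complex" and p and s :: "nat \<Rightarrow> 'a \<Rightarrow> 'b"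
    assume st: "\<forall>g. is_state (\<phi> g)" and s: "gns_tensor_norm \<phi> {h} {..<p} s \<le> 1"
    have pos: "positive_functional (\<phi> h)" using st state_positive by blast
    note lin = bounded_clinearD[of "\<phi> h"]
    have clin: "bounded_clinear (\<phi> h)" using pos by (simp add: positive_functional_def)
    have gns_norm: "gns_tensor_norm \<phi> {h} {..<p} t
        = sqrt (Re (\<phi> h (star (\<Sum>j<p. t j h) * (\<Sum>j<p. t j h))))" for t
      by (simp add: gns_tensor_norm_def star_sum sum_product lin[OF clin])
    define v where "v = (\<Sum>j<p. s j h)"
    have index: "{..<1::nat} \<times> {..<p} = Pair 0 ` {..<p}" by auto
    have "gns_tensor_norm \<phi> {h} ({..<1::nat} \<times> {..<p}) (\<lambda>(k, j) g. a * s j g)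
        = gns_tensor_norm \<phi> {h} {..<p} (\<lambda>j g. a * s j g)"
      unfolding gns_tensor_norm_def index by (simp add: sum.reindex inj_on_def)
    also have "\<dots> = sqrt (Re (\<phi> h (star (a * v) * (a * v))))"
      by (simp add: gns_norm v_def sum_distrib_left)
    also have "\<dots> \<le> sqrt ((norm a)\<^sup>2 * Re (\<phi> h (star v * v)))"
      by (intro real_sqrt_le_mono pos_functional_mult_bound pos)
    also have "\<dots> = norm a * sqrt (Re (\<phi> h (star v * v)))" by (simp add: real_sqrt_mult)
    also have "\<dots> \<le> norm a" using s by (simp add: gns_norm v_def mult_left_le)
    finally show "ereal (gns_tensor_norm \<phi> {h} ({..<1::nat} \<times> {..<p}) (\<lambda>(k, j) g. a * s j g))
        \<le> ereal (norm a)" by simp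
  qed
  moreover have "ereal (norm (tensor_sum \<iota> [h] 1 (\<lambda>_ _. a))) = min_tensor_norm (set [h]) 1 (\<lambda>_ _. a)"
    using assms by (simp only: infinite_min_tensor_power_def distinct_singleton)
  ultimately have "ereal (norm (\<iota> h a)) \<le> ereal (norm a)" by (simp add: tensor_sum_def)
  then show ?thesis by simp
qed

text \<open>
  Every trace on the tensor power, not only the product trace, makes a factor independent of
  everything that commutes with it. For \<open>y = z\<close> the left-hand side is a positive tracial functional of
  \<open>a\<close>, so by uniqueness of the trace it is a multiple of \<open>\<tau>\<close>. The general case follows by polarization.
\<close>

lemma trace_factor_independent:
  fixes \<iota> :: "'g \<Rightarrow> 'a::cstar_algebra \<Rightarrow> 'b::cstar_algebra" and t :: "'b \<Rightarrow> complex"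
  assumes uniq: "\<And>\<tau>'. is_trace \<tau>' \<Longrightarrow> \<tau>' = \<tau>" and power: "infinite_min_tensor_power \<iota>"
    and t: "is_trace t"
    and y: "\<And>a. y * \<iota> h a = \<iota> h a * y" and z: "\<And>a. z * \<iota> h a = \<iota> h a * z"
  shows "t (star y * z * \<iota> h a) = t (star y * z) * \<tau> a"
proof -
  have hom: "unital_star_hom (\<iota> h)" using power by (simp add: infinite_min_tensor_power_def)
  note hom_simps = unital_star_homD[OF hom]
  have comm: "t (x * y) = t (y * x)" for x y using t by (simp add: is_trace_def)
  have pos: "positive_functional t" using t by (simp add: is_trace_def state_positive)
  note lin = pos_functional_linear[OF pos]
  have diagonal: "t (star v * v * \<iota> h a) = t (star v * v) * \<tau> a"
    if v: "\<And>a. v * \<iota> h a = \<iota> h a * v" for v a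
  proof -
    have v': "star v * \<iota> h a = \<iota> h a * star v" for a
      using arg_cong[OF v[of "star a"], of star] by (simp add: star_mult hom_simps)
    let ?\<omega> = "\<lambda>a. t (star v * v * \<iota> h a)"
    have "bounded_linear (\<iota> h)"
      using factor_norm_le[OF power]
      by (intro bounded_linear_intro[of _ 1]) (auto simp: hom_simps scaleR_scaleC)
    then have "bounded_linear ?\<omega>"
      by (intro bounded_linear_compose[OF lin(6)] bounded_linear_compose[OF bounded_linear_mult_right])
    then have "bounded_clinear ?\<omega>"
      by (simp add: bounded_clinear_def hom_simps scaleC_mult_right lin scaleC_complex_def)
    moreover have "?\<omega> (star x * x) \<in> \<real>\<^sub>\<ge>\<^sub>0" for x
    proof -
      have "star v * v * \<iota> h (star x * x) = star v * (v * \<iota> h (star x)) * \<iota> h x"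
        by (simp add: hom_simps(3) mult.assoc)
      also have "\<dots> = (star v * \<iota> h (star x)) * (v * \<iota> h x)"
        unfolding v[of "star x"] by (simp only: mult.assoc)
      also have "\<dots> = star (v * \<iota> h x) * (v * \<iota> h x)"
        unfolding v' by (simp only: star_mult hom_simps(4))
      finally show ?thesis using pos by (simp add: positive_functional_def)
    qed
    moreover have "?\<omega> (x * y) = ?\<omega> (y * x)" for x y
    proof -
      have "?\<omega> (x * y) = t (\<iota> h y * (star v * v * \<iota> h x))"
        by (subst comm[symmetric]) (simp add: hom_simps(3) mult.assoc)
      also have "\<iota> h y * (star v * v * \<iota> h x) = (\<iota> h y * star v) * v * \<iota> h x"
        by (simp only: mult.assoc)
      also have "\<dots> = star v * (\<iota> h y * v) * \<iota> h x"
        unfolding v'[symmetric] by (simp only: mult.assoc)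
      also have "\<dots> = star v * v * \<iota> h (y * x)"
        unfolding v[symmetric] by (simp add: hom_simps(3) mult.assoc)
      finally show ?thesis .
    qed
    ultimately have "positive_functional ?\<omega>" "\<And>x y. ?\<omega> (x * y) = ?\<omega> (y * x)"
      by (simp_all only: positive_functional_def simp_thms)
    then have "?\<omega> a = ?\<omega> 1 * \<tau> a" by (intro unique_trace_scale uniq)
    then show ?thesis by (simp add: hom_simps)
  qed
  define L where "L v w = t (star v * w * \<iota> h a) - t (star v * w) * \<tau> a" for v w
  have L_add: "L (u + v) w = L u w + L v w" "L w (u + v) = L w u + L w v" for u v w
    by (simp_all add: L_def star_add distrib_left distrib_right lin)
  have L_scale: "L (c *\<^sub>C v) w = cnj c * L v w" "L v (c *\<^sub>C w) = c * L v w" for c v w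
    by (simp_all add: L_def star_scaleC scaleC_mult_left scaleC_mult_right lin right_diff_distrib)
  have L_zero: "L v v = 0" if "\<And>a. v * \<iota> h a = \<iota> h a * v" for v
    unfolding L_def using diagonal[OF that] by simp
  have "L (y + z) (y + z) = 0"
    by (rule L_zero) (simp add: y z distrib_left distrib_right)
  then have "L y z + L z y = 0"
    by (simp add: L_add L_zero[OF y] L_zero[OF z] add.commute)
  moreover have "L (y + \<i> *\<^sub>C z) (y + \<i> *\<^sub>C z) = 0"
    by (rule L_zero) (simp add: y z distrib_left distrib_right scaleC_mult_left scaleC_mult_right)
  then have "L y z = L z y"
    by (simp add: L_add L_scale L_zero[OF y] L_zero[OF z])
  ultimately have "L y z = 0" by simp
  then show ?thesis by (simp add: L_def)
qed

lemma infinite_tensor_power_commuting: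
  assumes "infinite_min_tensor_power \<iota>"
  shows "commuting_factors \<iota>"
proof
  show "unital_star_hom (\<iota> g)" for g
    using assms by (simp add: infinite_min_tensor_power_def)
  have "\<forall>g h a b. g \<noteq> h \<longrightarrow> \<iota> g a * \<iota> h b = \<iota> h b * \<iota> g a"
    using assms unfolding infinite_min_tensor_power_def by (elim conjE)
  then show "\<iota> g a * \<iota> h b = \<iota> h b * \<iota> g a" if "g \<noteq> h" for g h a b
    using that by blast
qed

section \<open>Outerness\<close>

text \<open>
  In the GNS space of \<open>t\<close> the vectors of \<open>c * \<iota> h a\<close> and \<open>c * \<iota> k a\<close> are orthogonal, since \<open>\<tau> a = 0\<close>,
  and have the same length, since the factors are independent of \<open>c\<close>.
\<close>

lemma trace_shifted_difference:
  fixes \<iota> :: "'g \<Rightarrow> 'a::cstar_algebra \<Rightarrow> 'b::cstar_algebra" and t :: "'b \<Rightarrow> complex"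
  assumes uniq: "\<And>\<tau>'. is_trace \<tau>' \<Longrightarrow> \<tau>' = \<tau>" and power: "infinite_min_tensor_power \<iota>"
    and t: "is_trace t" and a: "\<tau> a = 0" "\<tau> (star a) = 0" and "h \<noteq> k"
    and ch: "\<And>b. c * \<iota> h b = \<iota> h b * c" and ck: "\<And>b. c * \<iota> k b = \<iota> k b * c"
  shows "t (star (c * (\<iota> h a - \<iota> k a)) * (c * (\<iota> h a - \<iota> k a))) = 2 * t (star c * c) * \<tau> (a * star a)"
proof -
  interpret commuting_factors \<iota> using power by (rule infinite_tensor_power_commuting)
  have pos: "positive_functional t" using t by (simp add: is_trace_def state_positive)
  note lin = pos_functional_linear[OF pos]
  have comm: "t (x * y) = t (y * x)" for x y using t by (simp add: is_trace_def)
  let ?x = "\<iota> h a" and ?y = "\<iota> k a"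
  note independent = trace_factor_independent[OF uniq power t]
  have c_mult: "c * \<iota> k b * \<iota> h b' = \<iota> h b' * (c * \<iota> k b)" for b b'
  proof -
    have "c * \<iota> k b * \<iota> h b' = c * (\<iota> h b' * \<iota> k b)"
      unfolding commute[OF \<open>h \<noteq> k\<close>] by (rule mult.assoc)
    also have "\<dots> = c * \<iota> h b' * \<iota> k b" by (rule mult.assoc[symmetric])
    also have "\<dots> = \<iota> h b' * (c * \<iota> k b)" unfolding ch by (rule mult.assoc)
    finally show ?thesis .
  qed
  have cross_h: "t (star c * c * (?x * star ?y)) = 0"
  proof -
    have "star c * c * (?x * star ?y) = star c * (c * \<iota> k (star a)) * \<iota> h a"
      using commute[OF \<open>h \<noteq> k\<close>, of a "star a"] by (simp add: mult.assoc hom_simps(4))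
    also have "t \<dots> = t (star c * (c * \<iota> k (star a))) * \<tau> a"
      by (rule independent) (assumption | rule ch c_mult)+
    finally show ?thesis by (simp add: a)
  qed
  have cross_k: "t (star c * c * (?y * star ?x)) = 0"
  proof -
    have "star c * c * (?y * star ?x) = star c * (c * \<iota> k a) * \<iota> h (star a)"
      by (simp add: mult.assoc hom_simps)
    also have "t \<dots> = t (star c * (c * \<iota> k a)) * \<tau> (star a)"
      by (rule independent) (assumption | rule ch c_mult)+
    finally show ?thesis by (simp add: a)
  qed
  have square_h: "t (star c * c * (?x * star ?x)) = t (star c * c) * \<tau> (a * star a)"
    using independent[of c h c "a * star a"] ch by (simp add: hom_simps)
  have square_k: "t (star c * c * (?y * star ?y)) = t (star c * c) * \<tau> (a * star a)"
    using independent[of c k c "a * star a"] ck by (simp add: hom_simps)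
  \<comment> \<open>The trace property moves the two outer factors together, so that independence applies.\<close>
  have "t (star (c * (?x - ?y)) * (c * (?x - ?y))) = t (star c * c * ((?x - ?y) * star (?x - ?y)))"
    by (subst comm[of "star c * c"], simp add: star_mult mult.assoc) (subst comm, simp add: mult.assoc)
  also have "star c * c * ((?x - ?y) * star (?x - ?y)) = star c * c * (?x * star ?x)
      - star c * c * (?x * star ?y) - star c * c * (?y * star ?x) + star c * c * (?y * star ?y)"
    by (simp add: star_diff left_diff_distrib right_diff_distrib)
  also have "t \<dots> = 2 * t (star c * c) * \<tau> (a * star a)"
    unfolding lin square_h square_k cross_h cross_k by simp
  finally show ?thesis .
qed

text \<open>
  The vector \<open>W \<xi>\<close> is approximated by \<open>\<pi> c \<xi>\<close> with \<open>c\<close> a finite sum of elementary tensors over a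
  finite set \<open>gs\<close>. The group being infinite, there is a position \<open>h\<close> with \<open>h\<close> and \<open>g + h\<close> outside \<open>gs\<close>. Let
  \<open>R\<close> be right multiplication by \<open>\<iota> h a\<close>. As \<open>W\<close> commutes with \<open>R\<close> and moves \<open>\<iota> h a\<close> to \<open>\<iota> (g + h) a\<close>,
  \<open>R (W \<xi>) = W (\<pi> (\<iota> h a) \<xi>) = \<pi> (\<iota> (g + h) a) (W \<xi>)\<close>. Replacing \<open>W \<xi>\<close> by \<open>\<pi> c \<xi>\<close>
  shows that \<open>c * \<iota> h a\<close> and \<open>c * \<iota> (g + h) a\<close> have nearly the same vectors, with an error that does not
  depend on \<open>h\<close>. But they are orthogonal with length bounded below if \<open>a\<close> is a nonzero element of trace zero.
\<close>

lemma no_implementing_isometry: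
  fixes \<iota> :: "'g::group_add \<Rightarrow> 'a::cstar_algebra \<Rightarrow> 'b::cstar_algebra" and t :: "'b \<Rightarrow> complex"
    and \<tau> :: "'a \<Rightarrow> complex" and \<pi> :: "'b \<Rightarrow> 'h::complex_hilbert_space \<Rightarrow> 'h"
  assumes simple: "simple_cstar TYPE('a)" and tr: "is_trace \<tau>" and uniq: "\<And>\<tau>'. is_trace \<tau>' \<Longrightarrow> \<tau>' = \<tau>"
    and nontrivial: "\<not> cstar_isomorphic TYPE('a) TYPE(complex)"
    and power: "infinite_min_tensor_power \<iota>"
    and inf: "infinite (UNIV :: 'g set)" and "g \<noteq> 0"
    and t: "is_trace t" and gns: "gns_representation t \<pi> \<xi>"
    and W: "W \<in> generated_vn_algebra \<pi>" and iso: "\<And>v. norm (W v) = norm v"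
    and implement: "\<And>h a v. W (\<pi> (\<iota> h a) v) = \<pi> (\<iota> (g + h) a) (W v)"
  shows False
proof -
  have st: "is_state t" and comm: "\<And>x y. t (x * y) = t (y * x)"
    using t by (auto simp: is_trace_def)
  interpret commuting_factors \<iota> using power by (rule infinite_tensor_power_commuting)
  interpret gns t \<pi> \<xi> using st gns by unfold_locales
  have state: "is_state \<tau>" and comm_\<tau>: "\<And>x y. \<tau> (x * y) = \<tau> (y * x)"
    using tr by (auto simp: is_trace_def)
  note pos = state_positive[OF state]
  obtain a where a: "\<tau> a = 0" "a \<noteq> 0"
    by (rule nonzero_element_of_trace_zero[OF state nontrivial])
  have a': "\<tau> (star a) = 0" using pos_functional_hermitian[OF pos, of a 1] a by simp
  define q where "q = Re (\<tau> (a * star a))"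
  have \<tau>_q: "\<tau> (a * star a) = of_real q"
    using pos_functional_square[OF pos, of "star a"] by (simp add: q_def complex_eq_iff)
  have "\<tau> (a * star a) \<noteq> 0"
    using trace_faithful[OF simple tr, of a] a comm_\<tau>[of a "star a"] by auto
  then have q: "q > 0"
    using pos_functional_square[OF pos, of "star a"] by (simp add: \<tau>_q q_def[symmetric] less_le)
  define m where "m = norm a"
  have m: "m > 0" using a by (simp add: m_def)
  \<comment> \<open>Below, the distance is at most \<open>2me\<close> and its square at least \<open>2 (1 - e)\<^sup>2 q\<close>; this \<open>e\<close> gives \<open>q/4\<close> and \<open>q/2\<close>.\<close>
  define e where "e = min (1 / 2) (sqrt q / (4 * m))"
  have e: "e > 0" "e \<le> 1 / 2" "e \<le> sqrt q / (4 * m)" using q m by (auto simp: e_def)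
  obtain b where b: "dist (\<pi> b \<xi>) (W \<xi>) < e / 2"
    using dense_approximation[OF cyclic, of "e / 2" "W \<xi>"] e(1) by auto
  define D where "D = {tensor_sum \<iota> gs n a | gs n a. distinct gs}"
  have "closure D = UNIV" using power by (simp add: D_def infinite_min_tensor_power_def)
  then obtain c where "c \<in> D" and cb: "dist c b < e / 2"
    by (rule dense_approximation[of D "e / 2" b]) (use e(1) in simp)
  then obtain gs n f where c: "c = tensor_sum \<iota> gs n f" by (auto simp: D_def)
  define d where "d = \<pi> c \<xi> - W \<xi>"
  have d: "norm d < e"
  proof -
    have "norm (\<pi> (c - b) \<xi>) \<le> norm (c - b)"
      using contractive[of "c - b" \<xi>] by (simp add: norm_cyclic)
    then have "norm (\<pi> c \<xi> - \<pi> b \<xi>) < e / 2" using cb by (simp add: rep_diff dist_norm)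
    moreover have "norm d \<le> norm (\<pi> c \<xi> - \<pi> b \<xi>) + norm (\<pi> b \<xi> - W \<xi>)"
      unfolding d_def using norm_triangle_ineq[of "\<pi> c \<xi> - \<pi> b \<xi>" "\<pi> b \<xi> - W \<xi>"] by simp
    ultimately show ?thesis using b by (simp add: dist_norm)
  qed
  \<comment> \<open>The second set consists of the \<open>h\<close> with \<open>g + h\<close> in \<open>gs\<close>.\<close>
  have "finite (set gs \<union> (+) (- g) ` set gs)" by simp
  then obtain h where h: "h \<notin> set gs" "h \<notin> (+) (- g) ` set gs"
    using inf ex_new_if_finite by blast
  have gh: "g + h \<notin> set gs"
  proof
    assume "g + h \<in> set gs"
    then have "- g + (g + h) \<in> (+) (- g) ` set gs" by blast
    then show False using h(2) by simp
  qed
  have "h \<noteq> g + h"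
  proof
    assume "h = g + h"
    then have "0 + h = g + h" by simp
    then have "0 = g" by (simp only: add_right_cancel)
    then show False using \<open>g \<noteq> 0\<close> by simp
  qed
  have c_commute: "c * \<iota> k b = \<iota> k b * c" if "k \<notin> set gs" for k b
    unfolding c tensor_sum_elementary
    by (simp add: sum_distrib_left sum_distrib_right E_commute[OF that])
  let ?x = "\<iota> h a" and ?y = "\<iota> (g + h) a"
  obtain R where R: "R \<in> commutant (range \<pi>)" "\<And>b. R (\<pi> b \<xi>) = \<pi> (b * ?x) \<xi>"
    "\<And>v. norm (R v) \<le> norm ?x * norm v"
    using right_multiplication[OF comm, of ?x] by blast
  have R_lin: "R (u - v) = R u - R v" for u v
    using R(1) by (intro bounded_clinearD) (simp add: commutant_def)
  have "W \<circ> R = R \<circ> W"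
    using W R(1) by (simp add: generated_vn_algebra_def commutant_def[of "commutant (range \<pi>)"])
  then have "W (R \<xi>) = R (W \<xi>)" by (rule comp_eq_dest)
  moreover have "R \<xi> = \<pi> ?x \<xi>" using R(2)[of 1] by (simp add: rep)
  ultimately have RW: "R (W \<xi>) = \<pi> ?y (W \<xi>)" by (simp add: implement)
  have "\<pi> (c * (?x - ?y)) \<xi> = R (\<pi> c \<xi>) - \<pi> ?y (\<pi> c \<xi>)"
    by (simp add: R(2) right_diff_distrib rep_diff c_commute[OF gh] flip: rep(4))
  also have "\<dots> = R d - \<pi> ?y d"
    by (simp add: d_def R_lin RW bounded_clinearD(4)[OF rep(1)])
  also have "norm \<dots> \<le> norm ?x * norm d + norm ?y * norm d"
    using norm_triangle_ineq4[of "R d" "\<pi> ?y d"] R(3)[of d] contractive[of ?y d] by linarith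
  also have "\<dots> \<le> m * norm d + m * norm d"
    unfolding m_def by (intro add_mono mult_right_mono factor_norm_le power) auto
  also have "\<dots> \<le> 2 * m * e" using d m by simp
  also have "\<dots> \<le> 2 * m * (sqrt q / (4 * m))" using e(3) m by (intro mult_left_mono) auto
  also have "\<dots> = sqrt q / 2" using m by simp
  finally have "(norm (\<pi> (c * (?x - ?y)) \<xi>))\<^sup>2 \<le> (sqrt q / 2)\<^sup>2" by (intro power_mono) auto
  then have upper: "(norm (\<pi> (c * (?x - ?y)) \<xi>))\<^sup>2 \<le> q / 4" using q by (simp add: power_divide)
  have "(norm (\<pi> (c * (?x - ?y)) \<xi>))\<^sup>2 = 2 * Re (t (star c * c)) * q"
    unfolding norm_vector
    by (subst trace_shifted_difference[OF uniq power t a(1) a' \<open>h \<noteq> g + h\<close> c_commute[OF h(1)] c_commute[OF gh]])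
      (simp_all add: \<tau>_q)
  also have "Re (t (star c * c)) = (norm (\<pi> c \<xi>))\<^sup>2" by (rule norm_vector[symmetric])
  finally have "2 * (norm (\<pi> c \<xi>))\<^sup>2 * q \<le> q / 4" using upper by simp
  moreover have "(norm (\<pi> c \<xi>))\<^sup>2 \<ge> (1 / 2)\<^sup>2"
  proof (rule power_mono)
    have "norm (W \<xi>) \<le> norm (\<pi> c \<xi>) + norm d"
      using norm_triangle_ineq4[of "\<pi> c \<xi>" d] by (simp add: d_def)
    then show "1 / 2 \<le> norm (\<pi> c \<xi>)" using d e(2) by (simp add: iso norm_cyclic)
  qed simp
  then have "2 * (norm (\<pi> c \<xi>))\<^sup>2 * q \<ge> 2 * (1 / 2)\<^sup>2 * q"
    using q by (intro mult_right_mono mult_left_mono) auto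
  ultimately show False using q by (simp add: power2_eq_square)
qed

section \<open>The Bernoulli action of a free abelian group\<close>

lemma infinite_int_vector: "infinite (UNIV :: (int ^ 'm::finite) set)"
proof
  assume "finite (UNIV :: (int ^ 'm) set)"
  then have "finite (range (vec :: int \<Rightarrow> int ^ 'm))" by (rule finite_subset[rotated]) simp
  moreover have "inj (vec :: int \<Rightarrow> int ^ 'm)" by (simp add: inj_def vec_eq_iff)
  ultimately show False using finite_imageD infinite_UNIV_int by blast
qed

theorem proposition1p3:
  fixes \<iota> :: "int ^ 'm::finite \<Rightarrow> 'a::cstar_algebra \<Rightarrow> 'b::cstar_algebra"
    and \<sigma> :: "int ^ 'm \<Rightarrow> 'b \<Rightarrow> 'b"
  assumes "simple_cstar TYPE('a)"
    and "\<exists>!\<tau> :: 'a \<Rightarrow> complex. is_trace \<tau>"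
    and "\<not> cstar_isomorphic TYPE('a) TYPE(complex)"
    and "infinite_min_tensor_power \<iota>"
    and "bernoulli_action \<iota> \<sigma>"
  shows "strongly_outer TYPE('h::complex_hilbert_space) \<sigma>"
proof -
  obtain \<tau> :: "'a \<Rightarrow> complex" where \<tau>: "is_trace \<tau>" and uniq: "\<And>\<tau>'. is_trace \<tau>' \<Longrightarrow> \<tau>' = \<tau>"
    using assms(2) by blast
  interpret commuting_factors \<iota> using assms(4) by (rule infinite_tensor_power_commuting)
  have action: "cstar_action \<sigma>" and shift: "\<sigma> g (\<iota> h a) = \<iota> (g + h) a" for g h a
    using assms(5) by (auto simp: bernoulli_action_def)
  have hom_\<sigma>: "unital_star_hom (\<sigma> g)" for g
    using action by (simp add: cstar_action_def star_isomorphism_def)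
  have inverse: "\<sigma> g (\<sigma> (- g) b) = b" "\<sigma> (- g) (\<sigma> g b) = b" for g b
  proof -
    have "\<sigma> (g + h) = \<sigma> g \<circ> \<sigma> h" "\<sigma> 0 = id" for g h using action by (simp_all add: cstar_action_def)
    then show "\<sigma> g (\<sigma> (- g) b) = b" "\<sigma> (- g) (\<sigma> g b) = b"
      by (metis comp_apply id_apply add.right_inverse add.left_inverse)+
  qed
  show ?thesis
    unfolding strongly_outer_def
  proof (intro conjI allI impI)
    show "\<exists>t :: 'b \<Rightarrow> complex. is_trace t"
      using assms(4) by (intro product_trace_exists[OF \<tau>]) (auto simp: infinite_min_tensor_power_def)
  next
    fix g t and \<pi> :: "'b \<Rightarrow> 'h \<Rightarrow> 'h" and \<xi>
    assume g: "g \<noteq> 0" and t: "is_trace t" "t \<circ> \<sigma> g = t" and gns_t: "gns_representation t \<pi> \<xi>"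
    interpret gns t \<pi> \<xi> using t gns_t by unfold_locales (simp_all add: is_trace_def)
    show "\<exists>\<beta>. vn_extension \<pi> (\<sigma> g) \<beta>"
      using t(2) by (intro invariant_extension_exists[OF hom_\<sigma> hom_\<sigma>[of "- g"]] inverse) (metis comp_apply)
    fix \<beta> assume ext: "vn_extension \<pi> (\<sigma> g) \<beta>"
    show "outer_automorphism (generated_vn_algebra \<pi>) \<beta>"
      unfolding outer_automorphism_def
    proof
      assume "\<exists>W\<in>generated_vn_algebra \<pi>. unitary_op W \<and> (\<forall>x\<in>generated_vn_algebra \<pi>. \<beta> x = W \<circ> x \<circ> inv W)"
      then obtain W where W: "W \<in> generated_vn_algebra \<pi>" "unitary_op W"
        and inner: "\<And>x. x \<in> generated_vn_algebra \<pi> \<Longrightarrow> \<beta> x = W \<circ> x \<circ> inv W" by blast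
      have iso: "norm (W v) = norm v" for v
      proof -
        have "of_real ((norm (W v))\<^sup>2) = (of_real ((norm v)\<^sup>2) :: complex)"
          using W(2) by (simp only: unitary_op_def cinner_self[symmetric])
        then show ?thesis by (simp del: of_real_power)
      qed
      have "inj W"
      proof (rule injI)
        fix u v assume "W u = W v"
        then have "norm (W (u - v)) = 0"
          using W(2) by (simp add: unitary_op_def bounded_clinearD(4))
        then show "u = v" by (simp add: iso)
      qed
      have "\<pi> b \<in> generated_vn_algebra \<pi>" for b
        by (auto simp: generated_vn_algebra_def commutant_def rep)
      then have "\<pi> (\<sigma> g b) = W \<circ> \<pi> b \<circ> inv W" for b
        using inner ext by (metis vn_extension_def)
      then have implement: "W (\<pi> b v) = \<pi> (\<sigma> g b) (W v)" for b v
        using \<open>inj W\<close> by simp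
      show False
      proof (rule no_implementing_isometry[OF assms(1) \<tau> _ assms(3,4) infinite_int_vector g t(1) gns_t W(1) iso])
        show "\<tau>' = \<tau>" if "is_trace \<tau>'" for \<tau>' using that by (rule uniq)
        show "W (\<pi> (\<iota> h a) v) = \<pi> (\<iota> (g + h) a) (W v)" for h a v
          unfolding implement shift ..
      qed
    qed
  qed (rule action)
qed

end
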